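(* Let $\mathcal L$ be a countable relational language with maximum arity $t\geq 2$, and let $M$ be an ultrahomogeneous $\mathcal L$-structure such that $\mathrm{Th}(M)$ has quantifier elimination. Suppose that for every $\bar a\in\mathrm{Age}(M)$ with $|\bar a|<t$, $M$ has the $\bar a$-Ramsey property for externally atomic-definable $2$-colourings. Then $M$ has the externally definable Ramsey property.
   Context: A structure $M$ is ultrahomogeneous if every isomorphism between finite substructures of $M$ extends to an automorphism of $M$. $\mathrm{Age}(M)$ is the class of finite structures embeddable in $M$. Writing $\bar a\in\mathrm{Age}(M)$ means a structure $A\in\mathrm{Age}(M)$ together with an enumeration $\bar a$ (without repetition) of its elements. For a structure $B$, $\binom{B}{\bar a}=\{f(\bar a): f:A\to B \text{ an embedding}\}$. A $k$-colouring of $\binom{M}{\bar a}$ is a function $\chi:\binom{M}{\bar a}\to k=\{0,\dots,k-1\}$. It is externally definable if there are an elementary extension $N\succeq M$, a finite tuple $\bar e$ in $N$ and formulae $\phi_0(\bar x,\bar y),\dots,\phi_{k-1}(\bar x,\bar y)$ (no parameters) such that for all $\bar a'\in\binom{M}{\bar a}$ and $i<k$: $\chi(\bar a')=i\iff N\models\phi_i(\bar e,\bar a')$. A $2$-colouring $\chi$ is externally atomic-definable if there are $N\succeq M$, $\bar e$ in $N$ and an atomic formula $\phi(\bar x,\bar y)$ (possibly an equality) such that $\chi(\bar a')=0\iff N\models\phi(\bar e,\bar a')$ for all $\bar a'\in\binom{M}{\bar a}$. For a set $\Gamma$ of colourings of $\binom{M}{\bar a}$, $M$ has the $\bar a$-Ramsey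 property for $\Gamma$ if for every $B\in\mathrm{Age}(M)$ and every $\chi\in\Gamma$ there is a substructure $B'\subseteq M$ with $B'\cong B$ such that $\chi$ is constant on $\binom{B'}{\bar a}$. $M$ has the externally definable Ramsey property if for all $\bar a\in\mathrm{Age}(M)$ and all $k\geq1$, $M$ has the $\bar a$-Ramsey property for the set of all externally definable $k$-colourings of $\binom{M}{\bar a}$. *)

theory Defs
  imports Main "HOL-Library.Countable" "HOL-Library.FuncSet"
begin

text \<open>
  A relational language is a type \<open>'r\<close> of relation symbols together with an arity
  function \<open>ar :: 'r \<Rightarrow> nat\<close>.
\<close>

record ('r, 'a) struct =
  universe :: "'a set"
  rel :: "'r \<Rightarrow> 'a list set"

definition is_structure :: "('r \<Rightarrow> nat) \<Rightarrow> ('r, 'a) struct \<Rightarrow> bool" where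
  "is_structure ar A \<longleftrightarrow> (\<forall>r. rel A r \<subseteq> {xs. length xs = ar r \<and> set xs \<subseteq> universe A})"

definition embedding ::
  "('r \<Rightarrow> nat) \<Rightarrow> ('a \<Rightarrow> 'b) \<Rightarrow> ('r, 'a) struct \<Rightarrow> ('r, 'b) struct \<Rightarrow> bool" where
  "embedding ar f A B \<longleftrightarrow>
     inj_on f (universe A) \<and> f ` universe A \<subseteq> universe B \<and>
     (\<forall>r xs. length xs = ar r \<longrightarrow> set xs \<subseteq> universe A \<longrightarrow>
        (xs \<in> rel A r \<longleftrightarrow> map f xs \<in> rel B r))"

definition isomorphism ::
  "('r \<Rightarrow> nat) \<Rightarrow> ('a \<Rightarrow> 'b) \<Rightarrow> ('r, 'a) struct \<Rightarrow> ('r, 'b) struct \<Rightarrow> bool" where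
  "isomorphism ar f A B \<longleftrightarrow> embedding ar f A B \<and> f ` universe A = universe B"

definition isomorphic ::
  "('r \<Rightarrow> nat) \<Rightarrow> ('r, 'a) struct \<Rightarrow> ('r, 'b) struct \<Rightarrow> bool" where
  "isomorphic ar A B \<longleftrightarrow> (\<exists>f. isomorphism ar f A B)"

definition substructure ::
  "('r \<Rightarrow> nat) \<Rightarrow> ('r, 'a) struct \<Rightarrow> ('r, 'a) struct \<Rightarrow> bool" where
  "substructure ar A M \<longleftrightarrow>
     is_structure ar A \<and> universe A \<subseteq> universe M \<and>
     (\<forall>r xs. length xs = ar r \<longrightarrow> set xs \<subseteq> universe A \<longrightarrow> (xs \<in> rel A r \<longleftrightarrow> xs \<in> rel M r))"

definition ultrahomogeneous :: "('r \<Rightarrow> nat) \<Rightarrow> ('r, 'a) struct \<Rightarrow> bool" where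
  "ultrahomogeneous ar M \<longleftrightarrow>
     (\<forall>A B f. substructure ar A M \<longrightarrow> finite (universe A) \<longrightarrow>
        substructure ar B M \<longrightarrow> finite (universe B) \<longrightarrow> isomorphism ar f A B \<longrightarrow>
        (\<exists>g. isomorphism ar g M M \<and> (\<forall>x\<in>universe A. g x = f x)))"

text \<open>
  The age is realised on the element type of \<open>M\<close>: every structure that embeds in \<open>M\<close>
  has an isomorphic copy there, so every isomorphism type of the age is represented.
\<close>

definition age :: "('r \<Rightarrow> nat) \<Rightarrow> ('r, 'a) struct \<Rightarrow> ('r, 'a) struct set" where
  "age ar M = {A. is_structure ar A \<and> finite (universe A) \<and> (\<exists>f. embedding ar f A M)}"

definition enum_age ::
  "('r \<Rightarrow> nat) \<Rightarrow> ('r, 'a) struct \<Rightarrow> (('r, 'a) struct \<times> 'a list) set" where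
  "enum_age ar M = {(A, a). A \<in> age ar M \<and> distinct a \<and> set a = universe A}"

text \<open>The set of copies of the enumerated structure \<open>(A, a)\<close> in \<open>B\<close>, written \<open>binom(B, a)\<close>.\<close>

definition copies ::
  "('r \<Rightarrow> nat) \<Rightarrow> ('r, 'b) struct \<Rightarrow> ('r, 'a) struct \<Rightarrow> 'a list \<Rightarrow> 'b list set" where
  "copies ar B A a = {map f a |f. embedding ar f A B}"


datatype 'r fm =
    Bot
  | Eq nat nat
  | Rel 'r "nat list"
  | Neg "'r fm"
  | And "'r fm" "'r fm"
  | Ex nat "'r fm"

primrec wf_fm :: "('r \<Rightarrow> nat) \<Rightarrow> 'r fm \<Rightarrow> bool" where
  "wf_fm ar Bot \<longleftrightarrow> True"
| "wf_fm ar (Eq i j) \<longleftrightarrow> True"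
| "wf_fm ar (Rel r js) \<longleftrightarrow> length js = ar r"
| "wf_fm ar (Neg p) \<longleftrightarrow> wf_fm ar p"
| "wf_fm ar (And p q) \<longleftrightarrow> wf_fm ar p \<and> wf_fm ar q"
| "wf_fm ar (Ex i p) \<longleftrightarrow> wf_fm ar p"

primrec fv :: "'r fm \<Rightarrow> nat set" where
  "fv Bot = {}"
| "fv (Eq i j) = {i, j}"
| "fv (Rel r js) = set js"
| "fv (Neg p) = fv p"
| "fv (And p q) = fv p \<union> fv q"
| "fv (Ex i p) = fv p - {i}"

primrec quantifier_free :: "'r fm \<Rightarrow> bool" where
  "quantifier_free Bot \<longleftrightarrow> True"
| "quantifier_free (Eq i j) \<longleftrightarrow> True"
| "quantifier_free (Rel r js) \<longleftrightarrow> True"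
| "quantifier_free (Neg p) \<longleftrightarrow> quantifier_free p"
| "quantifier_free (And p q) \<longleftrightarrow> quantifier_free p \<and> quantifier_free q"
| "quantifier_free (Ex i p) \<longleftrightarrow> False"

definition atomic :: "'r fm \<Rightarrow> bool" where
  "atomic p \<longleftrightarrow> (\<exists>i j. p = Eq i j) \<or> (\<exists>r js. p = Rel r js)"

primrec sat :: "('r, 'a) struct \<Rightarrow> (nat \<Rightarrow> 'a) \<Rightarrow> 'r fm \<Rightarrow> bool" where
  "sat A v Bot \<longleftrightarrow> False"
| "sat A v (Eq i j) \<longleftrightarrow> v i = v j"
| "sat A v (Rel r js) \<longleftrightarrow> map v js \<in> rel A r"
| "sat A v (Neg p) \<longleftrightarrow> \<not> sat A v p"
| "sat A v (And p q) \<longleftrightarrow> sat A v p \<and> sat A v q"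
| "sat A v (Ex i p) \<longleftrightarrow> (\<exists>x\<in>universe A. sat A (v(i := x)) p)"

text \<open>The truth value of a sentence does not depend on the assignment \<open>v\<close>.\<close>

definition models :: "('r, 'a) struct \<Rightarrow> 'r fm set \<Rightarrow> bool" where
  "models A T \<longleftrightarrow> (\<forall>p\<in>T. \<forall>v. sat A v p)"

definition Th :: "('r \<Rightarrow> nat) \<Rightarrow> ('r, 'a) struct \<Rightarrow> 'r fm set" where
  "Th ar M = {p. wf_fm ar p \<and> fv p = {} \<and> (\<forall>v. sat M v p)}"

text \<open>
  HOL cannot quantify over types inside a formula, so the models of \<open>T\<close> range over the
  structures on one type \<open>'u\<close>. For \<open>T = Th ar M\<close> with \<open>M\<close> on \<open>'u\<close> nothing is lost: \<open>M\<close> is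
  one of these models, and all models of \<open>T\<close> satisfy the same sentences as \<open>M\<close>.
\<close>

definition has_QE :: "'u itself \<Rightarrow> ('r \<Rightarrow> nat) \<Rightarrow> 'r fm set \<Rightarrow> bool" where
  "has_QE _ ar T \<longleftrightarrow>
     (\<forall>p. wf_fm ar p \<longrightarrow>
        (\<exists>q. wf_fm ar q \<and> quantifier_free q \<and> fv q \<subseteq> fv p \<and>
           (\<forall>A :: ('r, 'u) struct. is_structure ar A \<longrightarrow> models A T \<longrightarrow>
              (\<forall>v. v ` fv p \<subseteq> universe A \<longrightarrow> (sat A v p \<longleftrightarrow> sat A v q)))))"

definition elementary_embedding ::
  "('r \<Rightarrow> nat) \<Rightarrow> ('a \<Rightarrow> 'b) \<Rightarrow> ('r, 'a) struct \<Rightarrow> ('r, 'b) struct \<Rightarrow> bool" where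
  "elementary_embedding ar h M N \<longleftrightarrow>
     h ` universe M \<subseteq> universe N \<and>
     (\<forall>p v. wf_fm ar p \<longrightarrow> v ` fv p \<subseteq> universe M \<longrightarrow> (sat M v p \<longleftrightarrow> sat N (h \<circ> v) p))"


text \<open>
  Colourings are functions on all lists of which only the values on \<open>copies ar M A a\<close>
  matter.

  An elementary extension of \<open>M\<close> is given by an elementary embedding \<open>h\<close> of \<open>M\<close> into a
  structure \<open>N\<close> on the type \<open>'n\<close>. In \<open>p(x, y)\<close> the variables \<open>x\<close> are \<open>0, ..., length e - 1\<close>
  and the variables \<open>y\<close> are the \<open>length a\<close> following ones, so the assignment is
  \<open>nth (e @ map h a')\<close>.

  For a countable language (\<open>'r :: countable\<close>), the type \<open>'n = 'a + nat\<close> already captures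
  all elementary extensions \<open>N\<close>: by the downward Loewenheim-Skolem theorem, \<open>N\<close> may be
  replaced by an elementary substructure that contains \<open>M\<close> and \<open>e\<close> and has cardinality at
  most \<open>|M| + aleph_0\<close>, and such a structure has an isomorphic copy on \<open>'a + nat\<close>.
\<close>

definition externally_definable ::
  "'n itself \<Rightarrow> ('r \<Rightarrow> nat) \<Rightarrow> ('r, 'a) struct \<Rightarrow> ('r, 'a) struct \<Rightarrow> 'a list \<Rightarrow>
     nat \<Rightarrow> ('a list \<Rightarrow> nat) \<Rightarrow> bool" where
  "externally_definable _ ar M A a k \<chi> \<longleftrightarrow>
     \<chi> \<in> copies ar M A a \<rightarrow> {..<k} \<and>
     (\<exists>(N :: ('r, 'n) struct) h e p.
        is_structure ar N \<and> elementary_embedding ar h M N \<and> set e \<subseteq> universe N \<and>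
        (\<forall>i<k. wf_fm ar (p i) \<and> fv (p i) \<subseteq> {..<length e + length a}) \<and>
        (\<forall>a'\<in>copies ar M A a. \<forall>i<k. \<chi> a' = i \<longleftrightarrow> sat N (nth (e @ map h a')) (p i)))"

definition externally_atomic_definable ::
  "'n itself \<Rightarrow> ('r \<Rightarrow> nat) \<Rightarrow> ('r, 'a) struct \<Rightarrow> ('r, 'a) struct \<Rightarrow> 'a list \<Rightarrow>
     ('a list \<Rightarrow> nat) \<Rightarrow> bool" where
  "externally_atomic_definable _ ar M A a \<chi> \<longleftrightarrow>
     \<chi> \<in> copies ar M A a \<rightarrow> {..<2} \<and>
     (\<exists>(N :: ('r, 'n) struct) h e p.
        is_structure ar N \<and> elementary_embedding ar h M N \<and> set e \<subseteq> universe N \<and>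
        atomic p \<and> wf_fm ar p \<and> fv p \<subseteq> {..<length e + length a} \<and>
        (\<forall>a'\<in>copies ar M A a. \<chi> a' = 0 \<longleftrightarrow> sat N (nth (e @ map h a')) p))"

definition ramsey_property ::
  "('r \<Rightarrow> nat) \<Rightarrow> ('r, 'a) struct \<Rightarrow> ('r, 'a) struct \<Rightarrow> 'a list \<Rightarrow>
     ('a list \<Rightarrow> nat) set \<Rightarrow> bool" where
  "ramsey_property ar M A a \<Gamma> \<longleftrightarrow>
     (\<forall>B\<in>age ar M. \<forall>\<chi>\<in>\<Gamma>.
        \<exists>B'. substructure ar B' M \<and> isomorphic ar B' B \<and>
             (\<exists>c. \<forall>a'\<in>copies ar B' A a. \<chi> a' = c))"

definition externally_definable_ramsey_property ::
  "'n itself \<Rightarrow> ('r \<Rightarrow> nat) \<Rightarrow> ('r, 'a) struct \<Rightarrow> bool" where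
  "externally_definable_ramsey_property N ar M \<longleftrightarrow>
     (\<forall>(A, a)\<in>enum_age ar M. \<forall>k\<ge>1.
        ramsey_property ar M A a {\<chi>. externally_definable N ar M A a k \<chi>})"

end

(* By quantifier elimination an externally definable colouring is a Boolean combination of finitely
   many atomic ones. An atomic formula without parameters has the same value on all copies; one with a
   parameter mentions fewer than t entries of the tuple, so the hypothesis applies to the subtuple.

   To make finitely many atomic colourings constant simultaneously, pick for each finite F in M, by
   the hypothesis and ultrahomogeneity, an automorphism g_F of M such that the first colouring is
   constant on the copies in g_F(F). In the ultrapower of N along the finite subsets of M, the map
   m |-> [h (g_F m)] is again an elementary embedding of M, and the colourings that it defines are the
   limits of the given ones composed with g_F. Induction applied to the remaining colourings of this
   ultrapower (cut down to the cardinality of M by Loewenheim-Skolem) gives an automorphism g, and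
   g_G o g works for the original colourings if G is a large enough finite set. *)

theory Submission
  imports Defs
begin

section \<open>Satisfaction\<close>

text \<open>Provides the coding of formulas by natural numbers on which the Skolem closure below
  relies.\<close>

instance fm :: (countable) countable
  by countable_datatype

lemma finite_fv: "finite (fv p)"
  by (induction p) auto

lemma sat_cong:
  assumes "\<And>i. i \<in> fv p \<Longrightarrow> v i = w i"
  shows "sat A v p \<longleftrightarrow> sat A w p"
  using assms
proof (induction p arbitrary: v w)
  case (Rel r js)
  then have "map v js = map w js" by auto
  then show ?case by (metis sat.simps(3))
next
  case (Ex i p)
  have "sat A (v(i := x)) p \<longleftrightarrow> sat A (w(i := x)) p" for x
    using Ex.prems by (intro Ex.IH) auto
  then show ?case by simp
next
  case (And p q)
  have "sat A v p \<longleftrightarrow> sat A w p" "sat A v q \<longleftrightarrow> sat A w q"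
    using And.prems by (auto intro!: And.IH)
  then show ?case by simp
next
  case (Neg p)
  have "sat A v p \<longleftrightarrow> sat A w p"
    using Neg.prems by (auto intro!: Neg.IH)
  then show ?case by simp
qed auto

lemma sat_isomorphism:
  assumes "isomorphism ar f A B" "wf_fm ar p" "v ` fv p \<subseteq> universe A"
  shows "sat B (f \<circ> v) p \<longleftrightarrow> sat A v p"
  using assms(2,3)
proof (induction p arbitrary: v)
  case (Eq i j)
  have "inj_on f (universe A)"
    using assms(1) by (simp add: isomorphism_def embedding_def)
  then show ?case using Eq by (auto dest: inj_onD)
next
  case (Rel r js)
  then have "map v js \<in> rel A r \<longleftrightarrow> map f (map v js) \<in> rel B r"
    using assms(1) unfolding isomorphism_def embedding_def
    by (metis fv.simps(3) length_map list.set_map wf_fm.simps(3))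
  then show ?case by (simp add: comp_def)
next
  case (Ex i p)
  have B: "universe B = f ` universe A"
    using assms(1) by (simp add: isomorphism_def)
  have "sat B ((f \<circ> v)(i := f x)) p \<longleftrightarrow> sat A (v(i := x)) p" if "x \<in> universe A" for x
  proof -
    have "(f \<circ> v)(i := f x) = f \<circ> v(i := x)" by auto
    moreover have "v(i := x) ` fv p \<subseteq> universe A" using that Ex.prems by auto
    ultimately show ?thesis using Ex.IH Ex.prems(1) by (metis wf_fm.simps(6))
  qed
  then show ?case unfolding sat.simps B by blast
next
  case (And p q)
  then show ?case by (simp add: image_Un)
next
  case (Neg p)
  then show ?case by simp
qed auto

text \<open>Used to close a formula into a sentence: the iterated quantifiers collapse into one
  assignment \<open>w\<close>, also when \<open>xs\<close> has repetitions.\<close>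

lemma sat_foldr_Ex:
  "sat A v (foldr Ex xs p) \<longleftrightarrow>
     (\<exists>w. (\<forall>i\<in>set xs. w i \<in> universe A) \<and> (\<forall>i. i \<notin> set xs \<longrightarrow> w i = v i) \<and> sat A w p)"
proof (induction xs arbitrary: v)
  case Nil
  have "(\<forall>i. w i = v i) \<longleftrightarrow> w = v" for w by auto
  then show ?case by simp
next
  case (Cons k xs)
  show ?case
  proof
    assume "sat A v (foldr Ex (k # xs) p)"
    then obtain x w where "x \<in> universe A" "\<forall>i\<in>set xs. w i \<in> universe A"
      "\<forall>i. i \<notin> set xs \<longrightarrow> w i = (v(k := x)) i" "sat A w p"
      by (simp only: foldr.simps comp_apply sat.simps Cons.IH) blast
    then show "\<exists>w. (\<forall>i\<in>set (k # xs). w i \<in> universe A) \<and>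
        (\<forall>i. i \<notin> set (k # xs) \<longrightarrow> w i = v i) \<and> sat A w p"
      by (intro exI[of _ w]) (auto split: if_splits)
  next
    assume "\<exists>w. (\<forall>i\<in>set (k # xs). w i \<in> universe A) \<and>
        (\<forall>i. i \<notin> set (k # xs) \<longrightarrow> w i = v i) \<and> sat A w p"
    then obtain w where "\<forall>i\<in>set (k # xs). w i \<in> universe A"
        "\<forall>i. i \<notin> set (k # xs) \<longrightarrow> w i = v i" "sat A w p" by blast
    moreover have "\<forall>i. i \<notin> set xs \<longrightarrow> w i = (v(k := w k)) i"
      using calculation(2) by simp
    ultimately have "sat A (v(k := w k)) (foldr Ex xs p)" "w k \<in> universe A"
      unfolding Cons.IH by (blast intro: list.set_intros)+
    then show "sat A v (foldr Ex (k # xs) p)" by auto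
  qed
qed

lemma fv_foldr_Ex: "fv (foldr Ex xs p) = fv p - set xs"
  by (induction xs) auto

lemma wf_fm_foldr_Ex: "wf_fm ar (foldr Ex xs p) = wf_fm ar p"
  by (induction xs) auto

text \<open>Equivalences over \<open>M\<close> are expressed by a sentence, so they pass to elementary extensions.\<close>

lemma elementary_embedding_transfer_equiv:
  assumes h: "elementary_embedding ar h M N"
    and "wf_fm ar p" "wf_fm ar q"
    and eqv: "\<And>v. v ` (fv p \<union> fv q) \<subseteq> universe M \<Longrightarrow> sat M v p \<longleftrightarrow> sat M v q"
    and v: "v ` (fv p \<union> fv q) \<subseteq> universe N"
  shows "sat N v p \<longleftrightarrow> sat N v q"
proof -
  \<comment> \<open>\<open>d\<close> says that exactly one of \<open>p\<close> and \<open>q\<close>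
    holds. Its existential closure is a sentence that fails in \<open>M\<close>, hence in
    \<open>N\<close>.\<close>
  define d where "d = Neg (And (Neg (And p (Neg q))) (Neg (And q (Neg p))))"
  have d: "sat A w d \<longleftrightarrow> sat A w p \<noteq> sat A w q" for A :: "('a, 'x) struct" and w
    by (auto simp: d_def)
  have fvd: "fv d = fv p \<union> fv q" by (auto simp: d_def)
  obtain xs where xs: "set xs = fv d"
    using finite_fv finite_list by blast
  have "wf_fm ar (foldr Ex xs d)" "fv (foldr Ex xs d) = {}"
    using assms(2,3) by (auto simp: wf_fm_foldr_Ex fv_foldr_Ex xs) (auto simp: d_def)
  then have *: "sat M w (foldr Ex xs d) \<longleftrightarrow> sat N (h \<circ> w) (foldr Ex xs d)" for w
    using h by (auto simp: elementary_embedding_def)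
  have "\<not> sat M w (foldr Ex xs d)" for w
    using eqv by (fastforce simp: sat_foldr_Ex xs fvd d)
  then have "\<not> sat N (h \<circ> w) (foldr Ex xs d)" for w
    using * by blast
  then have "\<not> (\<exists>w. (\<forall>i\<in>set xs. w i \<in> universe N) \<and> (\<forall>i. i \<notin> set xs \<longrightarrow> w i = (h \<circ> u) i) \<and> sat N w d)"
    for u by (simp add: sat_foldr_Ex)
  note no = this[of undefined]
  \<comment> \<open>Off the quantified variables \<open>w\<close> must agree with the fixed
    assignment \<open>h \<circ> undefined\<close>; these values do not affect
    \<open>d\<close>.\<close>
  define w where "w = (\<lambda>i. if i \<in> set xs then v i else (h \<circ> undefined) i)"
  have "\<forall>i\<in>set xs. w i \<in> universe N" "\<forall>i. i \<notin> set xs \<longrightarrow> w i = (h \<circ> undefined) i"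
    using v xs fvd by (auto simp: w_def)
  then have "\<not> sat N w d"
    using no by blast
  moreover have "sat N w d \<longleftrightarrow> sat N v d"
    by (rule sat_cong) (simp add: xs w_def)
  ultimately show ?thesis using d by blast
qed

section \<open>Ultrapowers\<close>

definition ultrafilter :: "'i filter \<Rightarrow> bool" where
  "ultrafilter U \<longleftrightarrow> U \<noteq> bot \<and> (\<forall>P. eventually P U \<or> eventually (\<lambda>i. \<not> P i) U)"

text \<open>Zorn's lemma for the reversed order on the proper filters below \<open>F\<close>. The
  infimum of a nonempty chain stays proper, since each of its events already belongs to a member of
  the chain. A minimal proper filter decides every \<open>P\<close>, because cutting it down to
  \<open>P\<close> yields either \<open>bot\<close> or the filter itself.\<close>

lemma ultrafilter_exists:
  fixes F :: "'i filter"
  assumes "F \<noteq> bot"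
  shows "\<exists>U\<le>F. ultrafilter U"
proof -
  define A where "A = {G. G \<noteq> bot \<and> G \<le> F}"
  have "\<exists>m\<in>A. \<forall>a\<in>A. a \<le> m \<longrightarrow> a = m"
  proof (rule predicate_Zorn)
    show "partial_order_on A (relation_of (\<lambda>x y. y \<le> x) A)"
      by (rule partial_order_on_relation_ofI) auto
    fix C assume C: "C \<in> Chains (relation_of (\<lambda>x y. y \<le> x) A)"
    have CA: "C \<subseteq> A" and tot: "\<And>x y. x \<in> C \<Longrightarrow> y \<in> C \<Longrightarrow> x \<le> y \<or> y \<le> x"
      using C by (auto simp: Chains_def relation_of_def)
    show "\<exists>u\<in>A. \<forall>a\<in>C. u \<le> a"
    proof (cases "C = {}")
      case True
      then show ?thesis using assms by (auto simp: A_def)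
    next
      case False
      have "eventually P (Inf C) \<longleftrightarrow> (\<exists>b\<in>C. eventually P b)" for P
        using eventually_Inf_base[of C P] False tot by (metis inf.absorb1 inf.absorb2 order_refl)
      moreover have "\<not> eventually (\<lambda>_. False) b" if "b \<in> C" for b
        using that CA by (auto simp: A_def trivial_limit_def)
      ultimately have "Inf C \<noteq> bot"
        by (simp add: trivial_limit_def)
      moreover have "Inf C \<le> F"
        using False CA by (auto simp: A_def intro: Inf_lower2)
      ultimately show ?thesis
        by (auto simp: A_def intro!: bexI[of _ "Inf C"] Inf_lower)
    qed
  qed
  then obtain U where UA: "U \<in> A" and "\<And>G. G \<in> A \<Longrightarrow> G \<le> U \<Longrightarrow> G = U"
    by blast
  then have U: "U \<noteq> bot" "U \<le> F" and max: "\<And>G. G \<noteq> bot \<Longrightarrow> G \<le> U \<Longrightarrow> G = U"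
    unfolding A_def by (auto dest: order_trans)
  have "eventually P U \<or> eventually (\<lambda>i. \<not> P i) U" for P
  proof (cases "inf U (principal {i. P i}) = bot")
    case True
    then have "eventually (\<lambda>i. False) (inf U (principal {i. P i}))" by simp
    then show ?thesis by (simp add: eventually_inf_principal)
  next
    case False
    then have "inf U (principal {i. P i}) = U" by (intro max) auto
    moreover have "eventually P (inf U (principal {i. P i}))"
      by (simp add: eventually_inf_principal)
    ultimately show ?thesis by simp
  qed
  with U show ?thesis by (auto simp: ultrafilter_def)
qed

lemma ultrafilter_eventually_not:
  assumes "ultrafilter U"
  shows "eventually (\<lambda>i. \<not> P i) U \<longleftrightarrow> \<not> eventually P U"
proof
  assume 1: "eventually (\<lambda>i. \<not> P i) U"
  show "\<not> eventually P U"
  proof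
    assume "eventually P U"
    with 1 have "eventually (\<lambda>i. False) U" by eventually_elim simp
    then show False using assms by (simp add: ultrafilter_def trivial_limit_def)
  qed
qed (use assms in \<open>auto simp: ultrafilter_def\<close>)

definition ultraclass :: "'i filter \<Rightarrow> ('i \<Rightarrow> 'b) \<Rightarrow> ('i \<Rightarrow> 'b) set" where
  "ultraclass U f = {g. eventually (\<lambda>i. f i = g i) U}"

lemma ultraclass_eq_iff: "ultraclass U f = ultraclass U g \<longleftrightarrow> eventually (\<lambda>i. f i = g i) U"
proof
  assume "ultraclass U f = ultraclass U g"
  moreover have "g \<in> ultraclass U g" by (simp add: ultraclass_def)
  ultimately have "g \<in> ultraclass U f" by (simp only:)
  then show "eventually (\<lambda>i. f i = g i) U" unfolding ultraclass_def by (rule CollectD)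
next
  assume *: "eventually (\<lambda>i. f i = g i) U"
  have "eventually (\<lambda>i. f i = k i) U \<longleftrightarrow> eventually (\<lambda>i. g i = k i) U" for k
    by (rule eventually_cong[OF *]) simp
  then show "ultraclass U f = ultraclass U g" unfolding ultraclass_def by (rule Collect_cong)
qed

text \<open>\<open>ultraclass\<close> collects all functions, also those leaving the universe of
  \<open>N\<close>, so the representatives are restricted here. A relation holds if it does so
  almost everywhere for some choice of representatives.\<close>

definition ultrapower :: "'i filter \<Rightarrow> ('r, 'b) struct \<Rightarrow> ('r, ('i \<Rightarrow> 'b) set) struct" where
  "ultrapower U N =
     \<lparr>universe = ultraclass U ` {f. range f \<subseteq> universe N},
      rel = \<lambda>r. {map (ultraclass U) fs |fs. (\<forall>f\<in>set fs. range f \<subseteq> universe N) \<and>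
                   eventually (\<lambda>i. map (\<lambda>f. f i) fs \<in> rel N r) U}\<rparr>"

lemma is_structure_ultrapower:
  assumes "is_structure ar N" "U \<noteq> bot"
  shows "is_structure ar (ultrapower U N)"
proof -
  have "length fs = ar r" if ev: "eventually (\<lambda>i. map (\<lambda>f. f i) fs \<in> rel N r) U" for fs r
  proof -
    obtain i where "map (\<lambda>f. f i) fs \<in> rel N r"
      using eventually_happens'[OF assms(2) ev] by blast
    then have "length (map (\<lambda>f. f i) fs) = ar r"
      using assms(1) unfolding is_structure_def by blast
    then show ?thesis by simp
  qed
  then show ?thesis by (auto simp: is_structure_def ultrapower_def)
qed

theorem Los:
  assumes "ultrafilter U" "\<And>k i. k \<in> fv p \<Longrightarrow> v k i \<in> universe N"
  shows "sat (ultrapower U N) (ultraclass U \<circ> v) p \<longleftrightarrow> eventually (\<lambda>i. sat N (\<lambda>k. v k i) p) U"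
  using assms(2)
proof (induction p arbitrary: v)
  case Bot
  then show ?case using assms(1) by (simp add: ultrafilter_def trivial_limit_def)
next
  case (Eq j k)
  then show ?case by (simp add: ultraclass_eq_iff)
next
  case (Rel r js)
  \<comment> \<open>Independence of the representatives: two choices agree almost everywhere in each
    of finitely many positions, hence in all positions at once.\<close>
  have "eventually (\<lambda>i. map (\<lambda>f. f i) fs \<in> rel N r) U
      \<longleftrightarrow> eventually (\<lambda>i. map (\<lambda>k. v k i) js \<in> rel N r) U"
    if fs: "map (ultraclass U) fs = map (ultraclass U \<circ> v) js" for fs
  proof -
    have len: "length fs = length js" using fs by (metis length_map)
    have "eventually (\<lambda>i. \<forall>m\<in>{..<length js}. (fs ! m) i = v (js ! m) i) U"
    proof (rule eventually_ball_finite, simp, safe)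
      fix m assume m: "m < length js"
      have "ultraclass U (fs ! m) = ultraclass U (v (js ! m))"
        using fs m len by (metis comp_apply nth_map)
      then show "eventually (\<lambda>i. (fs ! m) i = v (js ! m) i) U" by (simp add: ultraclass_eq_iff)
    qed
    then have "eventually (\<lambda>i. map (\<lambda>f. f i) fs = map (\<lambda>k. v k i) js) U"
      by eventually_elim (auto simp: list_eq_iff_nth_eq len)
    then show ?thesis
      by (rule eventually_cong) simp
  qed
  note key = this
  show ?case
  proof
    assume "sat (ultrapower U N) (ultraclass U \<circ> v) (Rel r js)"
    then obtain fs where "map (ultraclass U) fs = map (ultraclass U \<circ> v) js"
      "eventually (\<lambda>i. map (\<lambda>f. f i) fs \<in> rel N r) U"
      by (auto simp: ultrapower_def)
    then show "eventually (\<lambda>i. sat N (\<lambda>k. v k i) (Rel r js)) U"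
      using key by simp
  next
    assume "eventually (\<lambda>i. sat N (\<lambda>k. v k i) (Rel r js)) U"
    then show "sat (ultrapower U N) (ultraclass U \<circ> v) (Rel r js)"
      using Rel.prems
      by (auto simp: ultrapower_def comp_def intro!: exI[of _ "map v js"])
  qed
next
  case (Neg p)
  then show ?case using ultrafilter_eventually_not[OF assms(1)] by simp
next
  case (And p q)
  then show ?case by (simp add: eventually_conj_iff)
next
  case (Ex k p)
  have upd: "(ultraclass U \<circ> v)(k := ultraclass U f) = ultraclass U \<circ> v(k := f)" for f
    by (simp add: fun_upd_comp)
  have upd': "(\<lambda>j. (v(k := f)) j i) = (\<lambda>j. v j i)(k := f i)" for f i by auto
  have IH: "sat (ultrapower U N) ((ultraclass U \<circ> v)(k := ultraclass U f)) p \<longleftrightarrow>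
      eventually (\<lambda>i. sat N ((\<lambda>j. v j i)(k := f i)) p) U" if "range f \<subseteq> universe N" for f
    unfolding upd upd'[symmetric] using that Ex.prems by (intro Ex.IH) auto
  show ?case
  proof
    assume "sat (ultrapower U N) (ultraclass U \<circ> v) (Ex k p)"
    then obtain f where f: "range f \<subseteq> universe N"
      "sat (ultrapower U N) ((ultraclass U \<circ> v)(k := ultraclass U f)) p"
      by (auto simp: ultrapower_def)
    then have "eventually (\<lambda>i. sat N ((\<lambda>j. v j i)(k := f i)) p) U" using IH by blast
    then show "eventually (\<lambda>i. sat N (\<lambda>j. v j i) (Ex k p)) U"
      by eventually_elim (use f in auto)
  next
    assume *: "eventually (\<lambda>i. sat N (\<lambda>j. v j i) (Ex k p)) U"
    then obtain y where y: "y \<in> universe N"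
      using eventually_happens[OF *] assms(1) by (auto simp: ultrafilter_def)
    \<comment> \<open>A witness is chosen in every coordinate. Where there is none, the default
      \<open>y\<close> keeps the values of \<open>f\<close> in the universe of
      \<open>N\<close>.\<close>
    define f where "f i = (if \<exists>x\<in>universe N. sat N ((\<lambda>j. v j i)(k := x)) p
        then SOME x. x \<in> universe N \<and> sat N ((\<lambda>j. v j i)(k := x)) p else y)" for i
    have f: "f i \<in> universe N \<and>
        ((\<exists>x\<in>universe N. sat N ((\<lambda>j. v j i)(k := x)) p) \<longrightarrow> sat N ((\<lambda>j. v j i)(k := f i)) p)" for i
    proof (cases "\<exists>x\<in>universe N. sat N ((\<lambda>j. v j i)(k := x)) p")
      case True
      then have "\<exists>x. x \<in> universe N \<and> sat N ((\<lambda>j. v j i)(k := x)) p" by blast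
      from someI_ex[OF this] show ?thesis using True by (simp add: f_def)
    next
      case False
      then show ?thesis using y by (auto simp: f_def)
    qed
    from * have "eventually (\<lambda>i. sat N ((\<lambda>j. v j i)(k := f i)) p) U"
      by eventually_elim (use f in auto)
    then have "sat (ultrapower U N) ((ultraclass U \<circ> v)(k := ultraclass U f)) p"
      using IH f by blast
    then show "sat (ultrapower U N) (ultraclass U \<circ> v) (Ex k p)"
      using f by (auto simp: ultrapower_def)
  qed
qed

section \<open>The downward Loewenheim-Skolem theorem\<close>

definition tarski_vaught :: "('r, 'b) struct \<Rightarrow> 'b set \<Rightarrow> bool" where
  "tarski_vaught N S \<longleftrightarrow> S \<subseteq> universe N \<and>
     (\<forall>p i v. v ` (fv p - {i}) \<subseteq> S \<longrightarrow> (\<exists>x\<in>universe N. sat N (v(i := x)) p) \<longrightarrow>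
        (\<exists>x\<in>S. sat N (v(i := x)) p))"

lemma tarski_vaughtD:
  assumes "tarski_vaught N S" "v ` (fv p - {i}) \<subseteq> S" "x \<in> universe N" "sat N (v(i := x)) p"
  obtains y where "y \<in> S" "sat N (v(i := y)) p"
proof -
  have "\<exists>x\<in>universe N. sat N (v(i := x)) p" using assms(3,4) by (rule rev_bexI)
  then have "\<exists>y\<in>S. sat N (v(i := y)) p"
    using assms(1,2) by (simp add: tarski_vaught_def)
  then show ?thesis by (elim bexE) (rule that)
qed

text \<open>Cardinal arithmetic, |U x U| = |U| for infinite U, read as a decoding of elements into
  pairs.\<close>

lemma infinite_pairing:
  assumes "infinite (UNIV :: 'u set)"
  shows "\<exists>q :: 'u \<Rightarrow> 'u \<times> 'u. surj q"
proof -
  have "\<exists>q :: 'u \<Rightarrow> 'u \<times> 'u. q ` UNIV = (UNIV :: 'u set) \<times> (UNIV :: 'u set)"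
    by (rule card_of_ordLeq2[THEN iffD2,
          OF _ ordIso_imp_ordLeq[OF card_of_Times_same_infinite[OF assms]]]) simp
  then show ?thesis by simp
qed

text \<open>With \<open>q\<close> splitting a code into head and tail, \<open>s u k\<close> is entry
  \<open>k\<close> of the sequence coded by \<open>u\<close>. Prefixes of any length suffice later
  because a formula has finitely many free variables.\<close>

lemma infinite_finite_sequences:
  assumes "surj (q :: 'u \<Rightarrow> 'u \<times> 'u)"
  shows "\<exists>s :: 'u \<Rightarrow> nat \<Rightarrow> 'u. \<forall>v n. \<exists>u. \<forall>k<n. s u k = v k"
proof -
  define s where "s u k = fst (q (((snd \<circ> q) ^^ k) u))" for u k
  have "\<exists>u. \<forall>k<n. s u k = v k" for v n
  proof (induction n arbitrary: v)
    case (Suc n)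
    obtain u where u: "\<forall>k<n. s u k = v (Suc k)" using Suc[of "\<lambda>k. v (Suc k)"] by blast
    obtain u' where u': "q u' = (v 0, u)" using assms by (metis surjD)
    have "s u' k = v k" if "k < Suc n" for k
      using that u u' by (cases k) (auto simp: s_def funpow_swap1)
    then show ?case by blast
  qed auto
  then show ?thesis by blast
qed

text \<open>Skolem closure in countably many stages, each indexed by \<open>'a + nat\<close>: an
  index codes a formula, a variable and finitely many indices of the previous stage, and the next
  stage holds the chosen witness. The union works because the parameters of a formula all occur in a
  single stage.\<close>

lemma tarski_vaught_hull:
  fixes N :: "('r :: countable, 'n) struct" and g :: "'a + nat \<Rightarrow> 'n"
  assumes g: "range g \<subseteq> universe N"
  shows "\<exists>F :: 'a + nat \<Rightarrow> 'n. range g \<subseteq> range F \<and> tarski_vaught N (range F)"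
proof -
  \<comment> \<open>A Skolem function; \<open>g (Inr 0)\<close> is a default inside the
    universe.\<close>
  define W where "W p i v = (if \<exists>x\<in>universe N. sat N (v(i := x)) p
      then SOME x. x \<in> universe N \<and> sat N (v(i := x)) p else g (Inr 0))" for p i v
  have W: "W p i v \<in> universe N"
    "(\<exists>x\<in>universe N. sat N (v(i := x)) p) \<Longrightarrow> sat N (v(i := W p i v)) p" for p i v
  proof -
    have "W p i v \<in> universe N \<and>
        ((\<exists>x\<in>universe N. sat N (v(i := x)) p) \<longrightarrow> sat N (v(i := W p i v)) p)"
    proof (cases "\<exists>x\<in>universe N. sat N (v(i := x)) p")
      case True
      then have "\<exists>x. x \<in> universe N \<and> sat N (v(i := x)) p" by blast
      from someI_ex[OF this] show ?thesis using True by (simp add: W_def)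
    next
      case False
      then show ?thesis using g by (auto simp: W_def)
    qed
    then show "W p i v \<in> universe N"
      "(\<exists>x\<in>universe N. sat N (v(i := x)) p) \<Longrightarrow> sat N (v(i := W p i v)) p" by blast+
  qed
  have inf: "infinite (UNIV :: ('a + nat) set)" by simp
  obtain q :: "'a + nat \<Rightarrow> ('a + nat) \<times> ('a + nat)" where q: "surj q"
    using infinite_pairing[OF inf] by blast
  obtain s :: "'a + nat \<Rightarrow> nat \<Rightarrow> 'a + nat" where s: "\<And>v n. \<exists>u. \<forall>k<n. s u k = v k"
    using infinite_finite_sequences[OF q] by blast
  define num :: "'a + nat \<Rightarrow> nat" where "num = case_sum (\<lambda>_. 0) id"
  have num: "num (Inr n) = n" for n by (simp add: num_def)
  \<comment> \<open>An index \<open>u\<close> decodes to the code of the formula, the variable, and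
    the code of the parameter tuple, in this order.\<close>
  define step where "step f u = W (from_nat (num (fst (q u)))) (num (fst (q (snd (q u)))))
      (\<lambda>k. f (s (snd (q (snd (q u)))) k))" for f u
  have step: "\<exists>u. step f u = W p i (\<lambda>k. f (s c k))" for f p i c
  proof -
    obtain u' where u': "q u' = (Inr i, c)" using q by (metis surjD)
    obtain u where u: "q u = (Inr (to_nat p), u')" using q by (metis surjD)
    have "step f u = W p i (\<lambda>k. f (s c k))" by (simp add: step_def u u' num)
    then show ?thesis by blast
  qed
  define f where "f n = (step ^^ n) g" for n
  have f_univ: "f n u \<in> universe N" for n u
    using g W(1) by (cases n) (auto simp: f_def step_def)
  \<comment> \<open>\<open>v 1\<close> is the only witness for \<open>x = v 1\<close>, so a step keeps all earlier elements.\<close>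
  have f_Suc: "range (f n) \<subseteq> range (f (Suc n))" for n
  proof
    fix y assume "y \<in> range (f n)"
    then obtain u where u: "y = f n u" by blast
    obtain c where "\<forall>k<2. s c k = u" using s[of 2 "\<lambda>_. u"] by blast
    then have c: "s c 1 = u" by simp
    let ?v = "\<lambda>k. f n (s c k)"
    have "sat N (?v(0 := W (Eq 0 1) 0 ?v)) (Eq 0 1)"
      by (rule W(2), rule bexI[of _ y]) (simp_all add: c[simplified] u f_univ)
    then have "W (Eq 0 1) 0 ?v = y" by (simp add: c[simplified] u)
    moreover obtain u' where "step (f n) u' = W (Eq 0 1) 0 ?v" using step by blast
    ultimately have "y = f (Suc n) u'" by (simp add: f_def)
    then show "y \<in> range (f (Suc n))" by simp
  qed
  have f_mono: "range (f n) \<subseteq> range (f m)" if "n \<le> m" for n m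
    using that f_Suc by (rule lift_Suc_mono_le[rotated])
  \<comment> \<open>Pairing a stage with an index lets one map on \<open>'a + nat\<close> enumerate
    the union of all stages.\<close>
  define F where "F u = f (num (fst (q u))) (snd (q u))" for u
  have F: "range F = (\<Union>n. range (f n))"
  proof (intro equalityI subsetI)
    fix y assume "y \<in> (\<Union>n. range (f n))"
    then obtain n u where y: "y = f n u" by blast
    obtain u' where "q u' = (Inr n, u)" using q by (metis surjD)
    then have "y = F u'" by (simp add: F_def y num)
    then show "y \<in> range F" by simp
  qed (auto simp: F_def)
  have "\<exists>x\<in>range F. sat N (v(i := x)) p"
    if v: "v ` (fv p - {i}) \<subseteq> range F" and ex: "\<exists>x\<in>universe N. sat N (v(i := x)) p" for p i v
  proof -
    have fin: "finite (fv p - {i})" by (simp add: finite_fv)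
    have "\<exists>n. v k \<in> range (f n)" if "k \<in> fv p - {i}" for k
      using v that unfolding F by blast
    then obtain lev where lev: "\<And>k. k \<in> fv p - {i} \<Longrightarrow> v k \<in> range (f (lev k))" by metis
    obtain n where n: "\<And>k. k \<in> fv p - {i} \<Longrightarrow> lev k \<le> n"
      using finite_imageI[OF fin, of lev] by (metis finite_nat_set_iff_bounded_le image_eqI)
    \<comment> \<open>A code prescribes only a prefix of the assignment, so the prefix must be
      longer than every relevant variable.\<close>
    obtain b where b: "\<And>k. k \<in> fv p - {i} \<Longrightarrow> k < b"
      using fin by (metis finite_nat_set_iff_bounded)
    have "\<exists>u. v k = f n u" if "k \<in> fv p - {i}" for k
      using lev[OF that] f_mono[OF n[OF that]] by blast
    then obtain w where w: "\<And>k. k \<in> fv p - {i} \<Longrightarrow> v k = f n (w k)" by metis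
    obtain c where c: "\<forall>k<b. s c k = w k" using s by blast
    let ?v = "\<lambda>k. f n (s c k)"
    have eq: "sat N (v(i := x)) p \<longleftrightarrow> sat N (?v(i := x)) p" for x
      by (rule sat_cong) (use w b c in auto)
    obtain u where "step (f n) u = W p i ?v" using step by blast
    then have "W p i ?v = f (Suc n) u" by (simp add: f_def)
    then have "W p i ?v \<in> range F" unfolding F by blast
    moreover have "sat N (?v(i := W p i ?v)) p"
      using ex eq by (intro W(2)) blast
    ultimately show ?thesis using eq by blast
  qed
  moreover have "range F \<subseteq> universe N" using f_univ by (auto simp: F_def)
  ultimately have "tarski_vaught N (range F)" by (simp add: tarski_vaught_def)
  moreover have "range g = range (f 0)" by (simp add: f_def)
  then have "range g \<subseteq> range F" unfolding F by blast
  ultimately show ?thesis by blast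
qed

section \<open>Copying elementary substructures to another type\<close>

definition transport :: "('b \<Rightarrow> 'c) \<Rightarrow> 'b set \<Rightarrow> ('r, 'b) struct \<Rightarrow> ('r, 'c) struct" where
  "transport j S N = \<lparr>universe = j ` S, rel = \<lambda>r. {map j xs |xs. xs \<in> rel N r \<and> set xs \<subseteq> S}\<rparr>"

lemma is_structure_transport:
  assumes "is_structure ar N"
  shows "is_structure ar (transport j S N)"
proof -
  have "length xs = ar r" if "xs \<in> rel N r" for xs r
    using assms that unfolding is_structure_def by blast
  then show ?thesis by (fastforce simp: is_structure_def transport_def)
qed

text \<open>The Tarski-Vaught condition serves the existential case: a witness in \<open>N\<close>
  is exchanged for one in \<open>S\<close>, which \<open>j\<close> carries over.\<close>

lemma sat_transport:
  assumes "tarski_vaught N S" "inj_on j S" "v ` fv p \<subseteq> S"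
  shows "sat (transport j S N) (j \<circ> v) p \<longleftrightarrow> sat N v p"
  using assms(3)
proof (induction p arbitrary: v)
  case (Eq i k)
  then show ?case using assms(2) by (simp add: inj_on_eq_iff)
next
  case (Rel r js)
  have *: "map v js = xs" if "map j (map v js) = map j xs" "set xs \<subseteq> S" for xs
  proof (rule map_inj_on[OF that(1)])
    have "set (map v js) \<union> set xs \<subseteq> S" using that(2) Rel by simp
    then show "inj_on j (set (map v js) \<union> set xs)" using assms(2) inj_on_subset by blast
  qed
  have "sat (transport j S N) (j \<circ> v) (Rel r js) \<longleftrightarrow>
      (\<exists>xs. map j (map v js) = map j xs \<and> xs \<in> rel N r \<and> set xs \<subseteq> S)"
    by (simp add: transport_def)
  also have "\<dots> \<longleftrightarrow> map v js \<in> rel N r"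
  proof
    assume "map v js \<in> rel N r"
    moreover have "set (map v js) \<subseteq> S" using Rel by simp
    ultimately show "\<exists>xs. map j (map v js) = map j xs \<and> xs \<in> rel N r \<and> set xs \<subseteq> S" by blast
  next
    assume "\<exists>xs. map j (map v js) = map j xs \<and> xs \<in> rel N r \<and> set xs \<subseteq> S"
    then show "map v js \<in> rel N r" using * by blast
  qed
  finally show ?case by (simp add: comp_def)
next
  case (Neg p)
  then show ?case by simp
next
  case (And p q)
  then show ?case by (simp add: image_Un)
next
  case (Ex i p)
  have *: "sat (transport j S N) ((j \<circ> v)(i := j x)) p \<longleftrightarrow> sat N (v(i := x)) p" if "x \<in> S" for x
  proof -
    have "(j \<circ> v)(i := j x) = j \<circ> v(i := x)" by (simp add: fun_upd_comp)
    moreover have "v(i := x) ` fv p \<subseteq> S" using that Ex.prems by auto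
    ultimately show ?thesis using Ex.IH[of "v(i := x)"] by (simp only:)
  qed
  have univ: "universe (transport j S N) = j ` S" by (simp add: transport_def)
  show ?case
  proof
    assume "sat (transport j S N) (j \<circ> v) (Ex i p)"
    then obtain x where x: "x \<in> S" "sat (transport j S N) ((j \<circ> v)(i := j x)) p"
      unfolding sat.simps univ by (elim bexE imageE) simp
    then have "sat N (v(i := x)) p" using * by blast
    moreover have "x \<in> universe N" using x(1) assms(1) by (auto simp: tarski_vaught_def)
    ultimately show "sat N v (Ex i p)" unfolding sat.simps by (rule bexI)
  next
    assume "sat N v (Ex i p)"
    then obtain x where "x \<in> universe N" "sat N (v(i := x)) p" by auto
    moreover have "v ` (fv p - {i}) \<subseteq> S" using Ex.prems by simp
    ultimately obtain y where y: "y \<in> S" "sat N (v(i := y)) p"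
      by (elim tarski_vaughtD[OF assms(1), rotated])
    then have "sat (transport j S N) ((j \<circ> v)(i := j y)) p" using * by blast
    then show "sat (transport j S N) (j \<circ> v) (Ex i p)"
      unfolding sat.simps univ using y(1) by (intro bexI) auto
  qed
qed auto

lemma nth_append_map_comp:
  "k < length e + length a \<Longrightarrow> (map j e @ map (j \<circ> h) a) ! k = j ((e @ map h a) ! k)"
  by (auto simp: nth_append)

text \<open>Brings arbitrary external data to the type \<open>'a + nat\<close>, keeping the truth of
  all formulas in the parameters and in tuples from \<open>M\<close>. The closure is applied to a
  map listing \<open>M\<close> on the left summand and \<open>e\<close> on the right one.\<close>

theorem downward_Loewenheim_Skolem:
  fixes M :: "('r :: countable, 'a) struct" and N :: "('r, 'n) struct"
  assumes N: "is_structure ar N" and h: "elementary_embedding ar h M N" and e: "set e \<subseteq> universe N"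
  shows "\<exists>(N' :: ('r, 'a + nat) struct) h' e'.
    is_structure ar N' \<and> elementary_embedding ar h' M N' \<and> set e' \<subseteq> universe N' \<and>
    length e' = length e \<and>
    (\<forall>p a. fv p \<subseteq> {..<length e + length a} \<longrightarrow> set a \<subseteq> universe M \<longrightarrow>
      (sat N' (nth (e' @ map h' a)) p \<longleftrightarrow> sat N (nth (e @ map h a)) p))"
proof -
  have "\<exists>S (j :: 'n \<Rightarrow> 'a + nat). h ` universe M \<union> set e \<subseteq> S \<and> tarski_vaught N S \<and> inj_on j S"
  proof (cases "universe N = {}")
    \<comment> \<open>An empty universe offers no default value for the map \<open>g\<close> below;
      then \<open>M\<close> and \<open>e\<close> are empty too and \<open>S = {}\<close>
      works.\<close>
    case True
    then show ?thesis
      using e h by (intro exI[of _ "{}"]) (auto simp: tarski_vaught_def elementary_embedding_def)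
  next
    case False
    then obtain d where d: "d \<in> universe N" by blast
    define g where "g = case_sum (\<lambda>m. if m \<in> universe M then h m else d)
        (\<lambda>k. if k < length e then e ! k else d)"
    have hM: "h ` universe M \<subseteq> universe N" using h by (simp add: elementary_embedding_def)
    have "g x \<in> universe N" for x
      using d e hM by (cases x) (auto simp: g_def)
    then obtain F :: "'a + nat \<Rightarrow> 'n" where F: "range g \<subseteq> range F" "tarski_vaught N (range F)"
      using tarski_vaught_hull[of g N] by blast
    have "h m \<in> range g" if "m \<in> universe M" for m
      using that by (intro range_eqI[of _ _ "Inl m"]) (simp add: g_def)
    moreover have "x \<in> range g" if "x \<in> set e" for x
    proof -
      obtain k where "k < length e" "e ! k = x" using \<open>x \<in> set e\<close> by (metis in_set_conv_nth)
      then show ?thesis by (intro range_eqI[of _ _ "Inr k"]) (simp add: g_def)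
    qed
    ultimately have "h ` universe M \<union> set e \<subseteq> range F" using F(1) by blast
    \<comment> \<open>Choosing a preimage under the enumeration \<open>F\<close> injects the hull
      into \<open>'a + nat\<close>.\<close>
    moreover have "inj_on (inv F) (range F)" by (simp add: inj_on_inv_into)
    ultimately show ?thesis using F(2) by blast
  qed
  then obtain S and j :: "'n \<Rightarrow> 'a + nat" where
    S: "h ` universe M \<union> set e \<subseteq> S" and tv: "tarski_vaught N S" and j: "inj_on j S"
    by blast
  let ?N = "transport j S N"
  have "elementary_embedding ar (j \<circ> h) M ?N"
  proof -
    have "sat ?N (j \<circ> h \<circ> v) p \<longleftrightarrow> sat M v p" if "wf_fm ar p" "v ` fv p \<subseteq> universe M" for p v
    proof -
      have "(h \<circ> v) ` fv p \<subseteq> S" using that S by auto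
      then have "sat ?N (j \<circ> (h \<circ> v)) p \<longleftrightarrow> sat N (h \<circ> v) p" by (rule sat_transport[OF tv j])
      also have "\<dots> \<longleftrightarrow> sat M v p" using h that by (simp add: elementary_embedding_def)
      finally show ?thesis by (simp add: comp_assoc)
    qed
    moreover have "(j \<circ> h) ` universe M \<subseteq> universe ?N" using S by (auto simp: transport_def)
    ultimately show ?thesis by (simp add: elementary_embedding_def)
  qed
  moreover have "set (map j e) \<subseteq> universe ?N" using S by (auto simp: transport_def)
  moreover have "sat ?N (nth (map j e @ map (j \<circ> h) a)) p \<longleftrightarrow> sat N (nth (e @ map h a)) p"
    if fv: "fv p \<subseteq> {..<length e + length a}" and a: "set a \<subseteq> universe M" for p a
  proof -
    have "sat ?N (nth (map j e @ map (j \<circ> h) a)) p \<longleftrightarrow> sat ?N (j \<circ> nth (e @ map h a)) p"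
    proof (rule sat_cong)
      fix k assume "k \<in> fv p"
      then have "k < length e + length a" using fv by blast
      then show "(map j e @ map (j \<circ> h) a) ! k = (j \<circ> nth (e @ map h a)) k"
        by (simp add: nth_append_map_comp)
    qed
    also have "\<dots> \<longleftrightarrow> sat N (nth (e @ map h a)) p"
    proof (rule sat_transport[OF tv j])
      have "set (e @ map h a) \<subseteq> S" using S a by auto
      then show "nth (e @ map h a) ` fv p \<subseteq> S"
        using fv nth_mem[of _ "e @ map h a"] by (simp add: subset_iff image_iff) blast
    qed
    finally show ?thesis .
  qed
  ultimately show ?thesis
    using is_structure_transport[OF N]
    by (intro exI[of _ ?N] exI[of _ "j \<circ> h"] exI[of _ "map j e"]) simp
qed

section \<open>Copies and automorphisms\<close>

definition induced :: "('r, 'a) struct \<Rightarrow> 'a set \<Rightarrow> ('r, 'a) struct" where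
  "induced M F = \<lparr>universe = F, rel = \<lambda>r. {xs \<in> rel M r. set xs \<subseteq> F}\<rparr>"

lemma universe_induced [simp]: "universe (induced M F) = F"
  by (simp add: induced_def)

lemma is_structure_induced: "is_structure ar M \<Longrightarrow> is_structure ar (induced M F)"
  by (auto simp: is_structure_def induced_def)

lemma substructure_induced:
  "is_structure ar M \<Longrightarrow> F \<subseteq> universe M \<Longrightarrow> substructure ar (induced M F) M"
  by (simp add: substructure_def is_structure_induced) (auto simp: induced_def)

lemma embedding_id_substructure: "substructure ar A M \<Longrightarrow> embedding ar id A M"
  by (auto simp: substructure_def embedding_def)

lemma embedding_comp:
  assumes f: "embedding ar f A B" and g: "embedding ar g B C"
  shows "embedding ar (g \<circ> f) A C"
proof -
  have fu: "f ` universe A \<subseteq> universe B" using f by (simp add: embedding_def)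
  have "xs \<in> rel A r \<longleftrightarrow> map (g \<circ> f) xs \<in> rel C r"
    if "length xs = ar r" "set xs \<subseteq> universe A" for r xs
  proof -
    have "xs \<in> rel A r \<longleftrightarrow> map f xs \<in> rel B r"
      using f that by (simp add: embedding_def)
    also have "\<dots> \<longleftrightarrow> map g (map f xs) \<in> rel C r"
    proof -
      have "length (map f xs) = ar r" "set (map f xs) \<subseteq> universe B" using that fu by auto
      then show ?thesis using g unfolding embedding_def by blast
    qed
    finally show ?thesis by simp
  qed
  moreover have "inj_on (g \<circ> f) (universe A)"
    using f g by (intro comp_inj_on) (auto simp: embedding_def intro: inj_on_subset)
  moreover have "(g \<circ> f) ` universe A \<subseteq> universe C"
    using fu g by (auto simp: embedding_def)
  ultimately show ?thesis unfolding embedding_def by blast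
qed

lemma isomorphism_comp:
  "isomorphism ar f A B \<Longrightarrow> isomorphism ar g B C \<Longrightarrow> isomorphism ar (g \<circ> f) A C"
  unfolding isomorphism_def by (metis embedding_comp image_comp)

lemma isomorphism_inv_into:
  assumes "isomorphism ar f A B"
  shows "isomorphism ar (inv_into (universe A) f) B A"
proof -
  let ?g = "inv_into (universe A) f"
  have inj: "inj_on f (universe A)" and im: "f ` universe A = universe B"
    using assms by (auto simp: isomorphism_def embedding_def)
  have "xs \<in> rel B r \<longleftrightarrow> map ?g xs \<in> rel A r"
    if "length xs = ar r" "set xs \<subseteq> universe B" for r xs
  proof -
    have "length (map ?g xs) = ar r" by (simp add: that)
    moreover have "set (map ?g xs) \<subseteq> universe A"
      using that im by (auto intro!: inv_into_into)
    ultimately have "map ?g xs \<in> rel A r \<longleftrightarrow> map f (map ?g xs) \<in> rel B r"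
      using assms unfolding isomorphism_def embedding_def by blast
    moreover have "map f (map ?g xs) = xs"
      using that im by (auto intro!: map_idI simp: f_inv_into_f subset_iff)
    ultimately show ?thesis by simp
  qed
  moreover have "inj_on ?g (universe B)" "?g ` universe B = universe A"
    using im inj by (auto intro: inj_on_inv_into simp flip: im)
  ultimately show ?thesis unfolding isomorphism_def embedding_def by blast
qed

lemma isomorphism_induced:
  assumes "isomorphism ar g M M" "F \<subseteq> universe M"
  shows "isomorphism ar g (induced M F) (induced M (g ` F))"
proof -
  have "xs \<in> rel M r \<longleftrightarrow> map g xs \<in> rel M r"
    if "length xs = ar r" "set xs \<subseteq> F" for r xs
  proof -
    have "set xs \<subseteq> universe M" using that assms(2) by blast
    then show ?thesis using assms(1) that(1) unfolding isomorphism_def embedding_def by blast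
  qed
  moreover have "inj_on g F"
    using assms by (auto simp: isomorphism_def embedding_def intro: inj_on_subset)
  ultimately show ?thesis
    by (simp add: isomorphism_def embedding_def) (auto simp: induced_def)
qed

lemma sat_embedding_atomic:
  assumes "embedding ar f A B" "atomic p" "wf_fm ar p" "v ` fv p \<subseteq> universe A"
  shows "sat B (f \<circ> v) p \<longleftrightarrow> sat A v p"
proof (cases p)
  case (Eq i j)
  have "inj_on f (universe A)" using assms(1) by (simp add: embedding_def)
  then show ?thesis using assms(4) Eq by (auto dest: inj_onD)
next
  case (Rel r js)
  have "length (map v js) = ar r" "set (map v js) \<subseteq> universe A"
    using assms(3,4) Rel by auto
  then have "map v js \<in> rel A r \<longleftrightarrow> map f (map v js) \<in> rel B r"
    using assms(1) unfolding embedding_def by blast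
  then show ?thesis using Rel by (simp add: comp_def)
qed (use assms(2) in \<open>auto simp: atomic_def\<close>)

lemma copies_map:
  assumes "a' \<in> copies ar B A a" "embedding ar g B C"
  shows "map g a' \<in> copies ar C A a"
proof -
  obtain f where f: "a' = map f a" "embedding ar f A B"
    using assms(1) by (auto simp: copies_def)
  have "map g a' = map (g \<circ> f) a" by (simp add: f)
  then show ?thesis using embedding_comp[OF f(2) assms(2)] unfolding copies_def by blast
qed

lemma copies_substructure:
  assumes "substructure ar B C"
  shows "copies ar B A a \<subseteq> copies ar C A a"
  using copies_map[OF _ embedding_id_substructure[OF assms]] by auto

lemma copies_lists:
  assumes "a' \<in> copies ar B A a" "set a = universe A"
  shows "set a' \<subseteq> universe B" "length a' = length a"
  using assms by (auto simp: copies_def embedding_def)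

text \<open>Finiteness allows an ultrafilter to settle the colours of all copies at once.\<close>

lemma finite_copies:
  assumes "finite (universe B)" "set a = universe A"
  shows "finite (copies ar B A a)"
proof (rule finite_subset)
  show "copies ar B A a \<subseteq> {xs. set xs \<subseteq> universe B \<and> length xs = length a}"
    using copies_lists[OF _ assms(2)] by blast
  show "finite {xs. set xs \<subseteq> universe B \<and> length xs = length a}"
    by (rule finite_lists_length_eq[OF assms(1)])
qed

section \<open>External data and their ultralimits\<close>

text \<open>The data from which external colourings are read off. The induction over colourings
  varies it while \<open>M\<close> stays fixed.\<close>

definition external ::
  "('r \<Rightarrow> nat) \<Rightarrow> ('r, 'a) struct \<Rightarrow> ('r, 'n) struct \<Rightarrow> ('a \<Rightarrow> 'n) \<Rightarrow> 'n list \<Rightarrow> bool" where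
  "external ar M N h e \<longleftrightarrow>
     is_structure ar N \<and> elementary_embedding ar h M N \<and> set e \<subseteq> universe N"

lemma elementary_embedding_automorphism:
  assumes "elementary_embedding ar h M N" "isomorphism ar g M M"
  shows "elementary_embedding ar (h \<circ> g) M N"
proof -
  have gM: "g ` universe M = universe M" using assms(2) by (simp add: isomorphism_def)
  have "sat M v p \<longleftrightarrow> sat N (h \<circ> g \<circ> v) p" if "wf_fm ar p" "v ` fv p \<subseteq> universe M" for p v
  proof -
    have "(g \<circ> v) ` fv p \<subseteq> universe M" using that gM by auto
    then have "sat M (g \<circ> v) p \<longleftrightarrow> sat N (h \<circ> (g \<circ> v)) p"
      using assms(1) that(1) unfolding elementary_embedding_def by blast
    then show ?thesis using sat_isomorphism[OF assms(2) that] by (simp add: comp_assoc)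
  qed
  moreover have "(h \<circ> g) ` universe M \<subseteq> universe N"
    using assms(1) gM by (auto simp: elementary_embedding_def)
  ultimately show ?thesis unfolding elementary_embedding_def by blast
qed

text \<open>All \<open>h \<circ> g i\<close> are elementary, so by Los their ultralimit is
  elementary as well; the parameters become classes of constant functions. Thus the new data defines
  the limit along \<open>U\<close> of the colourings twisted by \<open>g i\<close>.
  Loewenheim-Skolem then restores the type \<open>'a + nat\<close>.\<close>

lemma external_ultralimit:
  fixes M :: "('r :: countable, 'a) struct" and N :: "('r, 'n) struct"
  assumes ext: "external ar M N h e" and g: "\<And>i. isomorphism ar (g i) M M"
    and U: "ultrafilter U"
  shows "\<exists>(N' :: ('r, 'a + nat) struct) h' e'. external ar M N' h' e' \<and> length e' = length e \<and>
    (\<forall>p a. fv p \<subseteq> {..<length e + length a} \<longrightarrow> set a \<subseteq> universe M \<longrightarrow>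
      (sat N' (nth (e' @ map h' a)) p \<longleftrightarrow>
        eventually (\<lambda>i. sat N (nth (e @ map h (map (g i) a))) p) U))"
proof -
  define h1 where "h1 m = ultraclass U (\<lambda>i. h (g i m))" for m
  define e1 where "e1 = map (\<lambda>x. ultraclass U (\<lambda>_. x)) e"
  have N: "is_structure ar N" and h: "elementary_embedding ar h M N" and e: "set e \<subseteq> universe N"
    using ext by (auto simp: external_def)
  have hg: "elementary_embedding ar (h \<circ> g i) M N" for i
    by (rule elementary_embedding_automorphism[OF h g])
  have hgN: "h (g i m) \<in> universe N" if "m \<in> universe M" for i m
    using hg[of i] that by (auto simp: elementary_embedding_def)
  have "sat (ultrapower U N) (h1 \<circ> v) p \<longleftrightarrow> sat M v p"
    if p: "wf_fm ar p" and v: "v ` fv p \<subseteq> universe M" for p v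
  proof -
    have "h1 \<circ> v = ultraclass U \<circ> (\<lambda>k i. h (g i (v k)))" by (auto simp: h1_def)
    moreover have "h (g i (v k)) \<in> universe N" if "k \<in> fv p" for k i
      using hgN v that by auto
    ultimately have "sat (ultrapower U N) (h1 \<circ> v) p \<longleftrightarrow>
        eventually (\<lambda>i. sat N (\<lambda>k. h (g i (v k))) p) U"
      using Los[OF U, of p "\<lambda>k i. h (g i (v k))"] by simp
    moreover have "sat N (\<lambda>k. h (g i (v k))) p \<longleftrightarrow> sat M v p" for i
    proof -
      have "sat M v p \<longleftrightarrow> sat N (h \<circ> g i \<circ> v) p"
        using hg[of i] p v unfolding elementary_embedding_def by blast
      then show ?thesis by (simp add: comp_def)
    qed
    ultimately show ?thesis using U by (auto simp: ultrafilter_def)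
  qed
  moreover have "h1 ` universe M \<subseteq> universe (ultrapower U N)"
    using hgN by (auto simp: h1_def ultrapower_def intro!: imageI)
  ultimately have 1: "elementary_embedding ar h1 M (ultrapower U N)"
    by (simp add: elementary_embedding_def)
  have 2: "is_structure ar (ultrapower U N)"
    using N U by (intro is_structure_ultrapower) (auto simp: ultrafilter_def)
  have 3: "set e1 \<subseteq> universe (ultrapower U N)"
    using e by (auto simp: e1_def ultrapower_def intro!: imageI)
  obtain N' :: "('r, 'a + nat) struct" and h' e' where
    N': "is_structure ar N'" "elementary_embedding ar h' M N'" "set e' \<subseteq> universe N'"
      "length e' = length e1" and
    eq: "\<And>p a. fv p \<subseteq> {..<length e1 + length a} \<Longrightarrow> set a \<subseteq> universe M \<Longrightarrow>
      sat N' (nth (e' @ map h' a)) p \<longleftrightarrow> sat (ultrapower U N) (nth (e1 @ map h1 a)) p"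
    using downward_Loewenheim_Skolem[OF 2 1 3] by blast
  have len: "length e1 = length e" by (simp add: e1_def)
  have "sat (ultrapower U N) (nth (e1 @ map h1 a)) p \<longleftrightarrow>
      eventually (\<lambda>i. sat N (nth (e @ map h (map (g i) a))) p) U"
    if fv: "fv p \<subseteq> {..<length e + length a}" and a: "set a \<subseteq> universe M" for p a
  proof -
    let ?v = "\<lambda>k i. (e @ map h (map (g i) a)) ! k"
    have "sat (ultrapower U N) (nth (e1 @ map h1 a)) p \<longleftrightarrow>
        sat (ultrapower U N) (ultraclass U \<circ> ?v) p"
    proof (rule sat_cong)
      fix k assume "k \<in> fv p"
      then have "k < length e + length a" using fv by blast
      then show "(e1 @ map h1 a) ! k = (ultraclass U \<circ> ?v) k"
        by (simp add: nth_append e1_def h1_def)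
    qed
    also have "\<dots> \<longleftrightarrow> eventually (\<lambda>i. sat N (\<lambda>k. ?v k i) p) U"
    proof (rule Los[OF U])
      fix k i assume "k \<in> fv p"
      then have "k < length (e @ map h (map (g i) a))" using fv by auto
      then have "?v k i \<in> set (e @ map h (map (g i) a))" by (rule nth_mem)
      then show "?v k i \<in> universe N" using e a hgN by auto
    qed
    finally show ?thesis by simp
  qed
  then show ?thesis
    using N' eq unfolding len external_def
    by (intro exI[of _ N'] exI[of _ h'] exI[of _ e']) simp
qed

section \<open>Finitely many atomic colourings simultaneously\<close>

text \<open>The Ramsey property gives a monochromatic copy of the structure on \<open>F\<close>, and
  ultrahomogeneity extends the isomorphism onto it to an automorphism. Unlike copies, automorphisms
  can be composed, as the induction below requires.\<close>

lemma ramsey_automorphism: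
  fixes M :: "('r :: countable, 'a) struct" and N :: "('r, 'a + nat) struct"
  assumes M: "is_structure ar M" "ultrahomogeneous ar M"
    and a: "set a = universe A"
    and ramsey: "ramsey_property ar M A a
      {\<chi>. externally_atomic_definable TYPE('a + nat) ar M A a \<chi>}"
    and ext: "external ar M N h e"
    and p: "atomic p" "wf_fm ar p" "fv p \<subseteq> {..<length e + length a}"
    and F: "finite F" "F \<subseteq> universe M"
  shows "\<exists>g. isomorphism ar g M M \<and>
    (\<exists>c. \<forall>a'\<in>copies ar (induced M F) A a. sat N (nth (e @ map h (map g a'))) p = c)"
proof -
  let ?B = "induced M F"
  define \<chi> :: "'a list \<Rightarrow> nat" where
    "\<chi> a' = (if sat N (nth (e @ map h a')) p then 0 else 1)" for a'
  have \<chi>: "\<chi> a' = 0 \<longleftrightarrow> sat N (nth (e @ map h a')) p" for a'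
    by (simp add: \<chi>_def)
  have "\<chi> \<in> copies ar M A a \<rightarrow> {..<2}" by (simp add: \<chi>_def)
  then have "externally_atomic_definable TYPE('a + nat) ar M A a \<chi>"
    unfolding externally_atomic_definable_def
    using ext p \<chi> unfolding external_def by blast
  moreover have sub: "substructure ar ?B M" using M(1) F(2) by (rule substructure_induced)
  then have "?B \<in> age ar M"
    using F(1) is_structure_induced[OF M(1)] embedding_id_substructure[OF sub] by (auto simp: age_def)
  ultimately obtain B' c where B': "substructure ar B' M" "isomorphic ar B' ?B"
    and c: "\<And>a'. a' \<in> copies ar B' A a \<Longrightarrow> \<chi> a' = c"
    using ramsey unfolding ramsey_property_def by blast
  obtain f where f: "isomorphism ar f B' ?B" using B'(2) by (auto simp: isomorphic_def)
  \<comment> \<open>The isomorphism at hand runs from \<open>B'\<close> to the structure on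
    \<open>F\<close>; ultrahomogeneity is applied to its inverse.\<close>
  let ?f = "inv_into (universe B') f"
  have f': "isomorphism ar ?f ?B B'" by (rule isomorphism_inv_into[OF f])
  then have "universe B' = ?f ` F" by (simp add: isomorphism_def)
  then have "finite (universe B')" using F(1) by (metis finite_imageI)
  then obtain g where g: "isomorphism ar g M M" "\<And>x. x \<in> F \<Longrightarrow> g x = ?f x"
    using M(2)[unfolded ultrahomogeneous_def, rule_format, OF sub _ B'(1) _ f'] F(1) by auto
  have "sat N (nth (e @ map h (map g a'))) p = (c = 0)" if a': "a' \<in> copies ar ?B A a" for a'
  proof -
    have "map ?f a' \<in> copies ar B' A a"
      using copies_map[OF a'] f' unfolding isomorphism_def by blast
    moreover have "map g a' = map ?f a'"
      using copies_lists(1)[OF a' a] g(2) by auto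
    ultimately show ?thesis using c \<chi> by metis
  qed
  then show ?thesis using g(1) by blast
qed

text \<open>Induction on \<open>L\<close> for arbitrary \<open>N\<close>, \<open>h\<close> and
  \<open>e\<close>, since the tail is treated in an ultralimit. Types stay fixed in an induction,
  which is why the ultralimit has to live on \<open>'a + nat\<close> again.\<close>

lemma simultaneous_ramsey_automorphism:
  fixes M :: "('r :: countable, 'a) struct" and N :: "('r, 'a + nat) struct"
    and L :: "(('r, 'a) struct \<times> 'a list \<times> 'r fm) list"
  assumes M: "is_structure ar M" "ultrahomogeneous ar M"
    and L: "\<And>A a p. (A, a, p) \<in> set L \<Longrightarrow>
      set a = universe A \<and> atomic p \<and> wf_fm ar p \<and> fv p \<subseteq> {..<length e + length a} \<and>
      ramsey_property ar M A a {\<chi>. externally_atomic_definable TYPE('a + nat) ar M A a \<chi>}"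
    and ext: "external ar M N h e"
    and F: "finite F" "F \<subseteq> universe M"
  shows "\<exists>g. isomorphism ar g M M \<and> (\<forall>(A, a, p)\<in>set L. \<exists>c. \<forall>a'\<in>copies ar (induced M F) A a.
    sat N (nth (e @ map h (map g a'))) p = c)"
  using L ext F
proof (induction L arbitrary: N h e F)
  case Nil
  have "isomorphism ar id M M" by (simp add: isomorphism_def embedding_def)
  then show ?case by auto
next
  case (Cons x L)
  obtain A a p where x: "x = (A, a, p)" by (cases x)
  note A = Cons.prems(1)[of A a p, unfolded x, simplified]
  let ?const = "\<lambda>g G. \<exists>c. \<forall>a'\<in>copies ar (induced M G) A a. sat N (nth (e @ map h (map g a'))) p = c"
  \<comment> \<open>For sets \<open>G\<close> that are not finite subsets of \<open>M\<close> the
    identity is the default, so that \<open>\<gamma>\<close> is total and consists of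
    automorphisms.\<close>
  have "\<exists>g. isomorphism ar g M M \<and> (G \<subseteq> universe M \<longrightarrow> finite G \<longrightarrow> ?const g G)" for G
  proof (cases "G \<subseteq> universe M \<and> finite G")
    case True
    then show ?thesis
      using ramsey_automorphism[OF M _ _ Cons.prems(2), of a A p G] A by blast
  next
    case False
    moreover have "isomorphism ar id M M" by (simp add: isomorphism_def embedding_def)
    ultimately show ?thesis by blast
  qed
  then obtain \<gamma> where \<gamma>: "\<And>G. isomorphism ar (\<gamma> G) M M"
    and \<gamma>_const: "\<And>G. G \<subseteq> universe M \<Longrightarrow> finite G \<Longrightarrow> ?const (\<gamma> G) G"
    by metis
  \<comment> \<open>Almost every \<open>G\<close> for \<open>U\<close> is a finite subset of
    \<open>M\<close> that contains any prescribed finite subset of \<open>M\<close>.\<close>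
  obtain U where U: "ultrafilter U" "U \<le> finite_subsets_at_top (universe M)"
    using ultrafilter_exists[OF finite_subsets_at_top_neq_bot] by blast
  obtain N' :: "('r, 'a + nat) struct" and h' e' where
    ext': "external ar M N' h' e'" and len: "length e' = length e" and
    lim: "\<And>q b. fv q \<subseteq> {..<length e + length b} \<Longrightarrow> set b \<subseteq> universe M \<Longrightarrow>
      sat N' (nth (e' @ map h' b)) q \<longleftrightarrow>
        eventually (\<lambda>G. sat N (nth (e @ map h (map (\<gamma> G) b))) q) U"
    using external_ultralimit[where g = \<gamma>, OF Cons.prems(2) \<gamma> U(1)] by blast
  have "\<exists>g. isomorphism ar g M M \<and> (\<forall>(A, a, p)\<in>set L. \<exists>c. \<forall>a'\<in>copies ar (induced M F) A a.
      sat N' (nth (e' @ map h' (map g a'))) p = c)"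
  proof (rule Cons.IH[OF _ ext' Cons.prems(3,4)])
    fix B b q assume "(B, b, q) \<in> set L"
    then show "set b = universe B \<and> atomic q \<and> wf_fm ar q \<and> fv q \<subseteq> {..<length e' + length b} \<and>
        ramsey_property ar M B b {\<chi>. externally_atomic_definable TYPE('a + nat) ar M B b \<chi>}"
      using Cons.prems(1)[of B b q] by (simp add: len)
  qed
  then obtain g where g: "isomorphism ar g M M" and
    g_const: "\<And>B b q. (B, b, q) \<in> set L \<Longrightarrow> \<exists>c. \<forall>b'\<in>copies ar (induced M F) B b.
      sat N' (nth (e' @ map h' (map g b'))) q = c"
    by fast
  have gM: "g ` universe M = universe M" using g by (simp add: isomorphism_def)
  have gF: "finite (g ` F)" "g ` F \<subseteq> universe M" using Cons.prems(3,4) gM by auto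
  \<comment> \<open>The ultrafilter decides the truth value at each tuple, so the limit is attained
    at almost every \<open>G\<close>.\<close>
  have agree: "eventually (\<lambda>G. sat N (nth (e @ map h (map (\<gamma> G) (map g b')))) q \<longleftrightarrow>
      sat N' (nth (e' @ map h' (map g b'))) q) U"
    if Bq: "(B, b, q) \<in> set L" and b': "b' \<in> copies ar (induced M F) B b" for B b q b'
  proof -
    have B: "set b = universe B" "fv q \<subseteq> {..<length e + length b}"
      using Cons.prems(1)[of B b q] Bq by auto
    have "set b' \<subseteq> F" "length b' = length b" using copies_lists[OF b' B(1)] by auto
    then have "sat N' (nth (e' @ map h' (map g b'))) q \<longleftrightarrow>
        eventually (\<lambda>G. sat N (nth (e @ map h (map (\<gamma> G) (map g b')))) q) U"
      using B(2) gF(2) by (intro lim) auto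
    moreover have "eventually (\<lambda>G. sat N (nth (e @ map h (map (\<gamma> G) (map g b')))) q) U \<or>
        eventually (\<lambda>G. \<not> sat N (nth (e @ map h (map (\<gamma> G) (map g b')))) q) U"
      using U(1) by (simp add: ultrafilter_def)
    moreover have "\<not> eventually (\<lambda>G. sat N (nth (e @ map h (map (\<gamma> G) (map g b')))) q) U"
      if "eventually (\<lambda>G. \<not> sat N (nth (e @ map h (map (\<gamma> G) (map g b')))) q) U"
      using that ultrafilter_eventually_not[OF U(1)] by blast
    ultimately show ?thesis by (auto elim: eventually_mono)
  qed
  have "eventually (\<lambda>G. \<forall>(B, b, q)\<in>set L. \<forall>b'\<in>copies ar (induced M F) B b.
      sat N (nth (e @ map h (map (\<gamma> G) (map g b')))) q \<longleftrightarrow>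
      sat N' (nth (e' @ map h' (map g b'))) q) U"
  proof (rule eventually_ball_finite, simp, safe)
    fix B b q assume Bq: "(B, b, q) \<in> set L"
    then have "finite (copies ar (induced M F) B b)"
      using Cons.prems(1)[of B b q] Cons.prems(3) by (intro finite_copies) auto
    then show "eventually (\<lambda>G. \<forall>b'\<in>copies ar (induced M F) B b.
        sat N (nth (e @ map h (map (\<gamma> G) (map g b')))) q \<longleftrightarrow>
        sat N' (nth (e' @ map h' (map g b'))) q) U"
      by (rule eventually_ball_finite) (use agree[OF Bq] in blast)
  qed
  moreover have "eventually (\<lambda>G. finite G \<and> g ` F \<subseteq> G \<and> G \<subseteq> universe M) U"
    by (rule filter_leD[OF U(2)]) (use gF in \<open>auto simp: eventually_finite_subsets_at_top\<close>)
  ultimately have ev: "eventually (\<lambda>G. (\<forall>(B, b, q)\<in>set L. \<forall>b'\<in>copies ar (induced M F) B b.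
      sat N (nth (e @ map h (map (\<gamma> G) (map g b')))) q \<longleftrightarrow>
      sat N' (nth (e' @ map h' (map g b'))) q) \<and> finite G \<and> g ` F \<subseteq> G \<and> G \<subseteq> universe M) U"
    by (rule eventually_conj)
  have "U \<noteq> bot" using U(1) by (simp add: ultrafilter_def)
  from eventually_happens'[OF this ev] obtain G where
    G: "finite G" "g ` F \<subseteq> G" "G \<subseteq> universe M" and
    G_agree: "\<And>B b q b'. (B, b, q) \<in> set L \<Longrightarrow> b' \<in> copies ar (induced M F) B b \<Longrightarrow>
      sat N (nth (e @ map h (map (\<gamma> G) (map g b')))) q \<longleftrightarrow>
      sat N' (nth (e' @ map h' (map g b'))) q"
    by fast
  have tail: "\<exists>c. \<forall>b'\<in>copies ar (induced M F) B b.
      sat N (nth (e @ map h (map (\<gamma> G \<circ> g) b'))) q = c"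
    if "(B, b, q) \<in> set L" for B b q
    using g_const[OF that] G_agree[OF that] by (simp add: comp_def)
  \<comment> \<open>\<open>\<gamma> G\<close> makes the head colouring constant on all copies inside
    \<open>G\<close>, and \<open>g\<close> embeds the structure on \<open>F\<close> into the one on
    \<open>G\<close>.\<close>
  have head: "?const (\<gamma> G \<circ> g) F"
  proof -
    have emb: "embedding ar g (induced M F) (induced M G)"
    proof -
      have "isomorphism ar g (induced M F) (induced M (g ` F))"
        using g Cons.prems(4) by (rule isomorphism_induced)
      then have "embedding ar g (induced M F) (induced M (g ` F))" by (simp add: isomorphism_def)
      moreover have "embedding ar id (induced M (g ` F)) (induced M G)"
        using G(2) by (auto simp: embedding_def induced_def)
      ultimately show ?thesis using embedding_comp by fastforce
    qed
    obtain c where c: "\<And>a'. a' \<in> copies ar (induced M G) A a \<Longrightarrow>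
        sat N (nth (e @ map h (map (\<gamma> G) a'))) p = c"
      using \<gamma>_const[OF G(3,1)] by blast
    have "sat N (nth (e @ map h (map (\<gamma> G \<circ> g) a'))) p = c"
      if "a' \<in> copies ar (induced M F) A a" for a'
      using c[OF copies_map[OF that emb]] by (simp add: comp_def)
    then show ?thesis by blast
  qed
  show ?case
  proof (intro exI conjI ballI)
    show "isomorphism ar (\<gamma> G \<circ> g) M M" using g \<gamma> by (rule isomorphism_comp)
    fix y assume "y \<in> set (x # L)"
    then consider "y = (A, a, p)" | B b q where "y = (B, b, q)" "(B, b, q) \<in> set L"
      using x by (metis prod_cases3 set_ConsD)
    then show "case y of (B, b, q) \<Rightarrow> \<exists>c. \<forall>b'\<in>copies ar (induced M F) B b.
        sat N (nth (e @ map h (map (\<gamma> G \<circ> g) b'))) q = c"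
      by cases (simp_all only: prod.case head tail)
  qed
qed

section \<open>Reduction to atomic formulas\<close>

primrec atoms :: "'r fm \<Rightarrow> 'r fm set" where
  "atoms Bot = {}"
| "atoms (Eq i j) = {Eq i j}"
| "atoms (Rel r js) = {Rel r js}"
| "atoms (Neg p) = atoms p"
| "atoms (And p q) = atoms p \<union> atoms q"
| "atoms (Ex i p) = atoms p"

lemma finite_atoms: "finite (atoms p)"
  by (induction p) auto

lemma atoms_atomic:
  assumes "q \<in> atoms p" "wf_fm ar p"
  shows "atomic q" "wf_fm ar q"
  using assms by (induction p) (auto simp: atomic_def)

lemma fv_atoms:
  assumes "q \<in> atoms p" "quantifier_free p"
  shows "fv q \<subseteq> fv p"
  using assms by (induction p) auto

lemma quantifier_free_sat_cong:
  assumes "quantifier_free p" "\<And>q. q \<in> atoms p \<Longrightarrow> sat A v q \<longleftrightarrow> sat B w q"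
  shows "sat A v p \<longleftrightarrow> sat B w p"
  using assms by (induction p) auto

text \<open>The arity bounds the variables of a relational atom; an equality can have two, which is
  where \<open>t \<ge> 2\<close> enters.\<close>

lemma card_fv_atomic:
  assumes "atomic p" "wf_fm ar p" "\<forall>r. ar r \<le> t" "t \<ge> 2"
  shows "card (fv p) \<le> t"
proof (cases p)
  case (Eq i j)
  then show ?thesis using assms(4) by (auto intro: order_trans[OF card_insert_le_m1])
next
  case (Rel r js)
  then show ?thesis using assms(2,3) card_length[of js] by (auto intro: order_trans)
qed (use assms(1) in \<open>auto simp: atomic_def\<close>)

text \<open>Bound variables stay in place without avoidance of capture, so the facts about
  \<open>rename\<close> are stated for atomic formulas.\<close>

primrec rename :: "(nat \<Rightarrow> nat) \<Rightarrow> 'r fm \<Rightarrow> 'r fm" where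
  "rename \<sigma> Bot = Bot"
| "rename \<sigma> (Eq i j) = Eq (\<sigma> i) (\<sigma> j)"
| "rename \<sigma> (Rel r js) = Rel r (map \<sigma> js)"
| "rename \<sigma> (Neg p) = Neg (rename \<sigma> p)"
| "rename \<sigma> (And p q) = And (rename \<sigma> p) (rename \<sigma> q)"
| "rename \<sigma> (Ex i p) = Ex i (rename \<sigma> p)"

lemma rename_atomic:
  assumes "atomic p"
  shows "atomic (rename \<sigma> p)" "wf_fm ar (rename \<sigma> p) \<longleftrightarrow> wf_fm ar p"
    "fv (rename \<sigma> p) = \<sigma> ` fv p" "sat A v (rename \<sigma> p) \<longleftrightarrow> sat A (v \<circ> \<sigma>) p"
  using assms by (auto simp: atomic_def)

text \<open>An atomic formula that mentions one of the \<open>m\<close> parameters mentions fewer than \<open>t\<close> of the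
  entries of the tuple; \<open>ys\<close> lists their positions.\<close>

lemma atomic_subtuple:
  fixes M :: "('r, 'a) struct" and p :: "'r fm"
  assumes ar: "\<forall>r. ar r \<le> t" "t \<ge> 2"
    and A: "(A, a) \<in> enum_age ar M"
    and p: "atomic p" "wf_fm ar p" "fv p \<subseteq> {..<m + length a}"
    and par: "fv p \<inter> {..<m} \<noteq> {}"
  shows "\<exists>ys q. set ys \<subseteq> {..<length a} \<and>
    (induced A (set (map (nth a) ys)), map (nth a) ys) \<in> enum_age ar M \<and> length ys < t \<and>
    atomic q \<and> wf_fm ar q \<and> fv q \<subseteq> {..<m + length ys} \<and>
    (\<forall>(N :: ('r, 'n) struct) h e (a' :: 'a list). length e = m \<longrightarrow> length a' = length a \<longrightarrow>
      (sat N (nth (e @ map h (map (nth a') ys))) q \<longleftrightarrow> sat N (nth (e @ map h a')) p))"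
proof -
  \<comment> \<open>The positions in the tuple that \<open>p\<close> mentions; position
    \<open>y\<close> belongs to the variable \<open>m + y\<close>.\<close>
  define Y where "Y = {y. m + y \<in> fv p}"
  have "(+) m ` Y \<subseteq> fv p" by (auto simp: Y_def)
  then have finY: "finite Y" using finite_fv finite_subset finite_imageD[of "(+) m" Y] by (metis inj_on_add)
  obtain ys where ys: "set ys = Y" "distinct ys" using finite_distinct_list[OF finY] by blast
  have Ylt: "Y \<subseteq> {..<length a}" using p(3) by (auto simp: Y_def)
  \<comment> \<open>Strict, because \<open>p\<close> has a variable below \<open>m\<close>, which
    the shifted set \<open>Y\<close> misses.\<close>
  have "card Y < card (fv p)"
  proof -
    have "card Y = card ((+) m ` Y)" by (simp add: card_image)
    also have "\<dots> < card (fv p)"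
    proof (rule psubset_card_mono[OF finite_fv])
      obtain i where "i \<in> fv p" "i < m" using par by blast
      moreover from this have "i \<notin> (+) m ` Y" by auto
      ultimately show "(+) m ` Y \<subset> fv p" using \<open>(+) m ` Y \<subseteq> fv p\<close> by blast
    qed
    finally show ?thesis .
  qed
  also have "\<dots> \<le> t" using card_fv_atomic[OF p(1,2) ar] .
  finally have lt: "length ys < t" using distinct_card[OF ys(2)] ys(1) by simp
  have "\<exists>k<length ys. ys ! k = y" if "y \<in> Y" for y
    using that ys(1) by (metis in_set_conv_nth)
  then obtain pos where pos: "\<And>y. y \<in> Y \<Longrightarrow> pos y < length ys \<and> ys ! pos y = y" by metis
  \<comment> \<open>Parameters keep their variables, while position \<open>y\<close> of the tuple
    moves to its place in \<open>ys\<close>.\<close>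
  define \<sigma> where "\<sigma> i = (if i < m then i else m + pos (i - m))" for i
  define q where "q = rename \<sigma> p"
  have \<sigma>: "i - m \<in> Y" if "i \<in> fv p" "\<not> i < m" for i
    using that by (simp add: Y_def)
  have "fv q \<subseteq> {..<m + length ys}"
    using pos \<sigma> by (fastforce simp: q_def rename_atomic(3)[OF p(1)] \<sigma>_def)
  moreover have "sat N (nth (e @ map h (map (nth a') ys))) q \<longleftrightarrow> sat N (nth (e @ map h a')) p"
    if "length e = m" "length a' = length a" for N :: "('r, 'n) struct" and h e and a' :: "'a list"
    unfolding q_def rename_atomic(4)[OF p(1)]
  proof (rule sat_cong)
    fix i assume i: "i \<in> fv p"
    show "(nth (e @ map h (map (nth a') ys)) \<circ> \<sigma>) i = (e @ map h a') ! i"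
    proof (cases "i < m")
      case True
      then show ?thesis using that by (simp add: \<sigma>_def nth_append)
    next
      case False
      then show ?thesis
        using that pos[OF \<sigma>[OF i False]] Ylt \<sigma>[OF i False] by (auto simp: \<sigma>_def nth_append)
    qed
  qed
  moreover have "(induced A (set (map (nth a) ys)), map (nth a) ys) \<in> enum_age ar M"
  proof -
    let ?S = "set (map (nth a) ys)"
    have a: "is_structure ar A" "distinct a" "set a = universe A"
      using A by (auto simp: enum_age_def age_def)
    obtain f where f: "embedding ar f A M" using A by (auto simp: enum_age_def age_def)
    have S: "?S \<subseteq> universe A" using Ylt ys(1) a(3)[symmetric] by auto
    have "embedding ar (f \<circ> id) (induced A ?S) M"
      by (intro embedding_comp[OF embedding_id_substructure f] substructure_induced a S)
    moreover have "distinct (map (nth a) ys)"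
      using ys Ylt inj_on_subset[OF inj_on_nth[OF a(2)], of "{..<length a}" Y]
      by (simp add: distinct_map)
    ultimately show ?thesis
      using is_structure_induced[OF a(1)] by (auto simp: enum_age_def age_def)
  qed
  ultimately show ?thesis
    using lt ys(1) Ylt p(1,2) by (intro exI[of _ ys] exI[of _ q]) (simp add: q_def rename_atomic)
qed

text \<open>The embedding behind \<open>a'\<close> restricts to the selected entries. Hence
  constancy on copies of the subtuple carries over to copies of \<open>a\<close>.\<close>

lemma copies_subtuple:
  assumes "a' \<in> copies ar B A a" "set a = universe A" "set ys \<subseteq> {..<length a}"
  shows "map (nth a') ys \<in> copies ar B (induced A (set (map (nth a) ys))) (map (nth a) ys)"
proof -
  let ?S = "set (map (nth a) ys)"
  obtain f where f: "a' = map f a" "embedding ar f A B" using assms(1) by (auto simp: copies_def)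
  have "?S \<subseteq> universe A" using assms(3) by (auto simp flip: assms(2))
  then have "embedding ar id (induced A ?S) A" by (auto simp: embedding_def induced_def)
  then have "embedding ar f (induced A ?S) B" using embedding_comp[OF _ f(2), of id] by simp
  moreover have "map (nth a') ys = map f (map (nth a) ys)" using f(1) assms(3) by auto
  ultimately show ?thesis unfolding copies_def by blast
qed

text \<open>Atomic formulas are preserved by the embeddings of \<open>A\<close> into
  \<open>M\<close> and of \<open>M\<close> into \<open>N\<close>. The value computed in
  \<open>A\<close> does not mention \<open>a'\<close>, so it is common to all copies; subtracting
  \<open>length e\<close> undoes the offset of the tuple variables.\<close>

lemma sat_parameter_free_atomic:
  assumes h: "elementary_embedding ar h M N"
    and p: "atomic p" "wf_fm ar p" "fv p \<subseteq> {..<length e + length a}" "fv p \<inter> {..<length e} = {}"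
    and a: "set a = universe A" and a': "a' \<in> copies ar M A a"
  shows "sat N (nth (e @ map h a')) p \<longleftrightarrow> sat A (\<lambda>i. a ! (i - length e)) p"
proof -
  let ?m = "length e"
  obtain f where f: "a' = map f a" "embedding ar f A M" using a' by (auto simp: copies_def)
  have ge: "?m \<le> i \<and> i < ?m + length a" if "i \<in> fv p" for i
    using that p(3,4) by force
  have univ: "(\<lambda>i. a ! (i - ?m)) ` fv p \<subseteq> universe A"
  proof safe
    fix i assume "i \<in> fv p"
    then have "i - ?m < length a" using ge by force
    then show "a ! (i - ?m) \<in> universe A" unfolding a[symmetric] by (rule nth_mem)
  qed
  have "sat N (nth (e @ map h a')) p \<longleftrightarrow> sat N (h \<circ> (f \<circ> (\<lambda>i. a ! (i - ?m)))) p"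
  proof (rule sat_cong)
    fix i assume "i \<in> fv p"
    then have "\<not> i < ?m" "i - ?m < length a" using ge by force+
    then show "(e @ map h a') ! i = (h \<circ> (f \<circ> (\<lambda>i. a ! (i - ?m)))) i"
      by (simp add: f(1) nth_append)
  qed
  also have "\<dots> \<longleftrightarrow> sat M (f \<circ> (\<lambda>i. a ! (i - ?m))) p"
  proof -
    have "(f \<circ> (\<lambda>i. a ! (i - ?m))) ` fv p \<subseteq> universe M"
      using univ f(2) by (auto simp: embedding_def)
    then show ?thesis using h p(2) unfolding elementary_embedding_def by blast
  qed
  also have "\<dots> \<longleftrightarrow> sat A (\<lambda>i. a ! (i - ?m)) p"
    by (rule sat_embedding_atomic[OF f(2) p(1,2) univ])
  finally show ?thesis .
qed

text \<open>\<open>has_QE\<close> speaks of structures on \<open>'a\<close> only. Its equivalence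
  holds in \<open>M\<close> and is transferred from there to \<open>N\<close>, which may live on
  another type.\<close>

lemma has_QE_external:
  fixes M :: "('r, 'a) struct"
  assumes "has_QE TYPE('a) ar (Th ar M)" "is_structure ar M" "elementary_embedding ar h M N"
    "wf_fm ar p"
  shows "\<exists>q. wf_fm ar q \<and> quantifier_free q \<and> fv q \<subseteq> fv p \<and>
    (\<forall>v. v ` fv p \<subseteq> universe N \<longrightarrow> (sat N v p \<longleftrightarrow> sat N v q))"
proof -
  have "models M (Th ar M)" by (auto simp: models_def Th_def)
  then obtain q where q: "wf_fm ar q" "quantifier_free q" "fv q \<subseteq> fv p"
    "\<And>v. v ` fv p \<subseteq> universe M \<Longrightarrow> sat M v p \<longleftrightarrow> sat M v q"
    using assms(1,2,4) unfolding has_QE_def by meson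
  have "fv p \<union> fv q = fv p" using q(3) by blast
  then have "sat N v p \<longleftrightarrow> sat N v q" if "v ` fv p \<subseteq> universe N" for v
    using elementary_embedding_transfer_equiv[OF assms(3,4) q(1)] q(4) that by simp
  then show ?thesis using q by blast
qed

theorem proposition3p13:
  fixes ar :: "'r :: countable \<Rightarrow> nat"
    and t :: nat
    and M :: "('r, 'a) struct"
  assumes "\<forall>r. ar r \<le> t" and "\<exists>r. ar r = t" and "t \<ge> 2"
    and "is_structure ar M"
    and "ultrahomogeneous ar M"
    and "has_QE TYPE('a) ar (Th ar M)"
    and "\<forall>(A, a)\<in>enum_age ar M. length a < t \<longrightarrow>
           ramsey_property ar M A a
             {\<chi>. externally_atomic_definable TYPE('a + nat) ar M A a \<chi>}"
  shows "externally_definable_ramsey_property TYPE('n) ar M"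
proof -
  have main: "\<exists>B'. substructure ar B' M \<and> isomorphic ar B' B \<and> (\<exists>c. \<forall>a'\<in>copies ar B' A a. \<chi> a' = c)"
    if Aa: "(A, a) \<in> enum_age ar M" and B: "B \<in> age ar M"
      and \<chi>: "externally_definable TYPE('n) ar M A a k \<chi>" for A a k B \<chi>
  proof -
    have a: "set a = universe A" using Aa by (simp add: enum_age_def)
    obtain N0 :: "('r, 'n) struct" and h0 e0 p where
      ext0: "is_structure ar N0" "elementary_embedding ar h0 M N0" "set e0 \<subseteq> universe N0" and
      p: "\<And>i. i < k \<Longrightarrow> wf_fm ar (p i) \<and> fv (p i) \<subseteq> {..<length e0 + length a}" and
      \<chi>0: "\<And>a' i. a' \<in> copies ar M A a \<Longrightarrow> i < k \<Longrightarrow>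
        \<chi> a' = i \<longleftrightarrow> sat N0 (nth (e0 @ map h0 a')) (p i)" and
      \<chi>_less: "\<chi> \<in> copies ar M A a \<rightarrow> {..<k}"
      using \<chi> unfolding externally_definable_def by blast
    \<comment> \<open>The hypothesis concerns colourings defined in structures on
      \<open>'a + nat\<close>, so the data is moved there first.\<close>
    obtain N :: "('r, 'a + nat) struct" and h e where
      N: "is_structure ar N" "elementary_embedding ar h M N" "set e \<subseteq> universe N"
        "length e = length e0" and
      eq: "\<And>q b. fv q \<subseteq> {..<length e0 + length b} \<Longrightarrow> set b \<subseteq> universe M \<Longrightarrow>
        sat N (nth (e @ map h b)) q \<longleftrightarrow> sat N0 (nth (e0 @ map h0 b)) q"
      using downward_Loewenheim_Skolem[OF ext0] by blast
    have ext: "external ar M N h e" using N by (simp add: external_def)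
    have "\<exists>q. i < k \<longrightarrow> wf_fm ar q \<and> quantifier_free q \<and> fv q \<subseteq> fv (p i) \<and>
        (\<forall>v. v ` fv (p i) \<subseteq> universe N \<longrightarrow> (sat N v (p i) \<longleftrightarrow> sat N v q))" for i
      using has_QE_external[OF assms(6,4) N(2), of "p i"] p by blast
    then obtain q where q: "\<And>i. i < k \<Longrightarrow> wf_fm ar (q i) \<and> quantifier_free (q i) \<and>
        fv (q i) \<subseteq> fv (p i) \<and>
        (\<forall>v. v ` fv (p i) \<subseteq> universe N \<longrightarrow> (sat N v (p i) \<longleftrightarrow> sat N v (q i)))"
      by metis
    have \<chi>_q: "\<chi> b = i \<longleftrightarrow> sat N (nth (e @ map h b)) (q i)"
      if b: "b \<in> copies ar M A a" and i: "i < k" for b i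
    proof -
      have b': "set b \<subseteq> universe M" "length b = length a" using copies_lists[OF b a] by auto
      have fv: "fv (p i) \<subseteq> {..<length e + length b}" using p[OF i] N(4) b'(2) by simp
      have "nth (e @ map h b) ` fv (p i) \<subseteq> universe N"
      proof safe
        fix j assume "j \<in> fv (p i)"
        then have "j < length (e @ map h b)" using fv by auto
        then have "(e @ map h b) ! j \<in> set (e @ map h b)" by (rule nth_mem)
        then show "(e @ map h b) ! j \<in> universe N"
          using N(2,3) b'(1) by (auto simp: elementary_embedding_def)
      qed
      then have "sat N (nth (e @ map h b)) (q i) \<longleftrightarrow> sat N (nth (e @ map h b)) (p i)"
        using q[OF i] by blast
      also have "\<dots> \<longleftrightarrow> sat N0 (nth (e0 @ map h0 b)) (p i)"
        using fv b'(1) N(4) by (intro eq) simp_all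
      finally show ?thesis using \<chi>0[OF b i] by blast
    qed
    let ?m = "length e"
    \<comment> \<open>The colour of a copy is determined by the truth values of these finitely many
      atoms.\<close>
    define \<Sigma> where "\<Sigma> = (\<Union>i<k. atoms (q i))"
    have \<Sigma>: "finite \<Sigma>" "\<And>s. s \<in> \<Sigma> \<Longrightarrow> atomic s \<and> wf_fm ar s \<and> fv s \<subseteq> {..<?m + length a}"
    proof -
      show "finite \<Sigma>" by (simp add: \<Sigma>_def finite_atoms)
      fix s assume "s \<in> \<Sigma>"
      then obtain i where i: "i < k" "s \<in> atoms (q i)" by (auto simp: \<Sigma>_def)
      then have "fv s \<subseteq> fv (p i)" using fv_atoms[of s "q i"] q[OF i(1)] by blast
      then show "atomic s \<and> wf_fm ar s \<and> fv s \<subseteq> {..<?m + length a}"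
        using atoms_atomic[OF i(2), of ar] q[OF i(1)] p[OF i(1)] N(4) by auto
    qed
    let ?sub = "\<lambda>ys. map (nth a) ys"
    have "\<exists>ys s'. s \<in> \<Sigma> \<longrightarrow> fv s \<inter> {..<?m} \<noteq> {} \<longrightarrow> set ys \<subseteq> {..<length a} \<and>
        (induced A (set (?sub ys)), ?sub ys) \<in> enum_age ar M \<and> length ys < t \<and>
        atomic s' \<and> wf_fm ar s' \<and> fv s' \<subseteq> {..<?m + length ys} \<and>
        (\<forall>(N :: ('r, 'a + nat) struct) h e (a' :: 'a list). length e = ?m \<longrightarrow>
          length a' = length a \<longrightarrow>
          (sat N (nth (e @ map h (map (nth a') ys))) s' \<longleftrightarrow> sat N (nth (e @ map h a')) s))" for s
      using atomic_subtuple[OF assms(1,3) Aa, of s ?m] \<Sigma>(2)[of s] by meson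
    then obtain ys s' where red: "\<And>s. s \<in> \<Sigma> \<Longrightarrow> fv s \<inter> {..<?m} \<noteq> {} \<Longrightarrow>
        set (ys s) \<subseteq> {..<length a} \<and>
        (induced A (set (?sub (ys s))), ?sub (ys s)) \<in> enum_age ar M \<and> length (ys s) < t \<and>
        atomic (s' s) \<and> wf_fm ar (s' s) \<and> fv (s' s) \<subseteq> {..<?m + length (ys s)} \<and>
        (\<forall>(N :: ('r, 'a + nat) struct) h e (a' :: 'a list). length e = ?m \<longrightarrow>
          length a' = length a \<longrightarrow>
          (sat N (nth (e @ map h (map (nth a') (ys s)))) (s' s) \<longleftrightarrow> sat N (nth (e @ map h a')) s))"
      by metis
    \<comment> \<open>Different atoms may mention different entries of \<open>a\<close>, so each
      item carries its own subtuple.\<close>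
    let ?item = "\<lambda>s. (induced A (set (?sub (ys s))), ?sub (ys s), s' s)"
    obtain L where L: "set L = ?item ` {s \<in> \<Sigma>. fv s \<inter> {..<?m} \<noteq> {}}"
      using \<Sigma>(1) finite_list[of "?item ` {s \<in> \<Sigma>. fv s \<inter> {..<?m} \<noteq> {}}"] by auto
    obtain f where f: "embedding ar f B M" using B by (auto simp: age_def)
    \<comment> \<open>\<open>B\<close> is merely embeddable in \<open>M\<close>; its image takes its
      place.\<close>
    define F where "F = f ` universe B"
    have F: "finite F" "F \<subseteq> universe M"
      using B f by (auto simp: F_def age_def embedding_def)
    have "\<exists>g. isomorphism ar g M M \<and> (\<forall>(A, a, p)\<in>set L. \<exists>c. \<forall>a'\<in>copies ar (induced M F) A a.
        sat N (nth (e @ map h (map g a'))) p = c)"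
    proof (rule simultaneous_ramsey_automorphism[OF assms(4,5) _ ext F])
      fix A1 a1 p1 assume "(A1, a1, p1) \<in> set L"
      then obtain s where s: "s \<in> \<Sigma>" "fv s \<inter> {..<?m} \<noteq> {}"
        and A1: "A1 = induced A (set (?sub (ys s)))" "a1 = ?sub (ys s)" "p1 = s' s"
        unfolding L by blast
      note red = red[OF s]
      have "(A1, a1) \<in> enum_age ar M" "length a1 < t" using red by (simp_all add: A1)
      then have "ramsey_property ar M A1 a1 {\<chi>. externally_atomic_definable TYPE('a + nat) ar M A1 a1 \<chi>}"
        using assms(7) by blast
      moreover have "set a1 = universe A1" by (simp add: A1)
      ultimately show "set a1 = universe A1 \<and> atomic p1 \<and> wf_fm ar p1 \<and>
          fv p1 \<subseteq> {..<length e + length a1} \<and>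
          ramsey_property ar M A1 a1 {\<chi>. externally_atomic_definable TYPE('a + nat) ar M A1 a1 \<chi>}"
        using red by (simp add: A1)
    qed
    then obtain g where g: "isomorphism ar g M M" and
      g_const: "\<And>A1 a1 p1. (A1, a1, p1) \<in> set L \<Longrightarrow> \<exists>c. \<forall>a'\<in>copies ar (induced M F) A1 a1.
        sat N (nth (e @ map h (map g a'))) p1 = c"
      by fast
    let ?B = "induced M (g ` F)"
    have gF: "g ` F \<subseteq> universe M" using g F(2) by (auto simp: isomorphism_def)
    have subB: "substructure ar ?B M" by (rule substructure_induced[OF assms(4) gF])
    have iso_g: "isomorphism ar g (induced M F) ?B" by (rule isomorphism_induced[OF g F(2)])
    have "isomorphism ar f B (induced M F)"
      using f by (auto simp: isomorphism_def embedding_def F_def induced_def)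
    then have "isomorphic ar ?B B"
      unfolding isomorphic_def using isomorphism_inv_into isomorphism_comp[OF _ iso_g] by blast
    moreover have "\<chi> b1 = \<chi> b2" if b: "b1 \<in> copies ar ?B A a" "b2 \<in> copies ar ?B A a" for b1 b2
    proof -
      have bM: "b1 \<in> copies ar M A a" "b2 \<in> copies ar M A a"
        using b copies_substructure[OF subB] by auto
      \<comment> \<open>Constancy is known for tuples \<open>map g c\<close> with \<open>c\<close> a
        copy inside \<open>F\<close>; pulling back along \<open>g\<close> shows that all copies in
        \<open>?B\<close> have this form.\<close>
      have pull: "\<exists>c\<in>copies ar (induced M F) A a. b' = map g c" if b': "b' \<in> copies ar ?B A a" for b'
      proof -
        let ?g = "inv_into F g"
        have "isomorphism ar ?g ?B (induced M F)"
          using isomorphism_inv_into[OF iso_g] by simp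
        then have "map ?g b' \<in> copies ar (induced M F) A a"
          using copies_map[OF b'] unfolding isomorphism_def by blast
        moreover have "map g (map ?g b') = b'"
          using copies_lists(1)[OF b' a] by (auto intro!: map_idI simp: f_inv_into_f subset_iff)
        ultimately show ?thesis by metis
      qed
      obtain c1 c2 where c: "c1 \<in> copies ar (induced M F) A a" "c2 \<in> copies ar (induced M F) A a"
        "b1 = map g c1" "b2 = map g c2"
        using pull[OF b(1)] pull[OF b(2)] by blast
      have len: "length c1 = length a" "length c2 = length a"
        using copies_lists(2)[OF _ a] c by auto
      have atom: "sat N (nth (e @ map h b1)) s \<longleftrightarrow> sat N (nth (e @ map h b2)) s" if s: "s \<in> \<Sigma>" for s
      proof (cases "fv s \<inter> {..<?m} = {}")
        case True
        then show ?thesis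
          using sat_parameter_free_atomic[OF N(2) _ _ _ True a bM(1)]
            sat_parameter_free_atomic[OF N(2) _ _ _ True a bM(2)] \<Sigma>(2)[OF s] by simp
      next
        case False
        note red = red[OF s False]
        have ysa: "set (ys s) \<subseteq> {..<length a}" using red by blast
        have "?item s \<in> set L" unfolding L using s False by blast
        from g_const[OF this] obtain d where d: "\<And>c. c \<in> copies ar (induced M F)
            (induced A (set (?sub (ys s)))) (?sub (ys s)) \<Longrightarrow>
            sat N (nth (e @ map h (map g c))) (s' s) = d" by blast
        have "sat N (nth (e @ map h (map g c))) s = d"
          if c: "c \<in> copies ar (induced M F) A a" for c
        proof -
          have lc: "length c = length a" by (rule copies_lists(2)[OF c a])
          \<comment> \<open>Selecting a subtuple commutes with \<open>g\<close>, so the constant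
            value \<open>d\<close> of the reduced colouring is also that of
            \<open>s\<close>.\<close>
          have "map g (map (nth c) (ys s)) = map (nth (map g c)) (ys s)"
            using ysa lc by auto
          then have "sat N (nth (e @ map h (map (nth (map g c)) (ys s)))) (s' s) = d"
            using d[OF copies_subtuple[OF c a ysa]] by metis
          moreover have "length (map g c) = length a" using lc by simp
          ultimately show ?thesis using red by blast
        qed
        then show ?thesis using c by blast
      qed
      \<comment> \<open>One formula suffices: \<open>q (\<chi> b1)\<close> holds at
        \<open>b1\<close>, hence at \<open>b2\<close>, which gives \<open>b2\<close> the same
        colour.\<close>
      have k: "\<chi> b1 < k" using \<chi>_less bM(1) by auto
      have "sat N (nth (e @ map h b1)) (q (\<chi> b1)) \<longleftrightarrow> sat N (nth (e @ map h b2)) (q (\<chi> b1))"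
      proof (rule quantifier_free_sat_cong)
        show "quantifier_free (q (\<chi> b1))" using q[OF k] by blast
        fix s assume "s \<in> atoms (q (\<chi> b1))"
        then have "s \<in> \<Sigma>" using k unfolding \<Sigma>_def by blast
        then show "sat N (nth (e @ map h b1)) s \<longleftrightarrow> sat N (nth (e @ map h b2)) s" by (rule atom)
      qed
      then show ?thesis using \<chi>_q[OF bM(1) k] \<chi>_q[OF bM(2) k] by simp
    qed
    then have "\<exists>c. \<forall>b\<in>copies ar ?B A a. \<chi> b = c" by blast
    ultimately show ?thesis using subB by blast
  qed
  show ?thesis
    unfolding externally_definable_ramsey_property_def
  proof clarify
    fix A a k assume "(A, a) \<in> enum_age ar M"
    then show "ramsey_property ar M A a {\<chi>. externally_definable TYPE('n) ar M A a k \<chi>}"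
      unfolding ramsey_property_def by (intro ballI main) (simp_all only: mem_Collect_eq)
  qed
qed

end
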